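(* Let $\omega$ be any one of the transformations $p_i,\ p'_i$ ($i\in\mathbb{Z}_{n+1}$), $\sigma,\ \sigma',\ \pi_1,\ \pi_2$ of $\widetilde{G}$ defined in the context. Let $\varepsilon$ denote the specialization $\varphi_{2k+1,1}\mapsto -1$ ($k=0,\ldots,n$), all other $\varphi_{j,i}$ being left unchanged. Under $\varepsilon$ one has $\varphi_{2k+1,0}=-\alpha_{2k+1}$ and $\varphi_{2k+1,1}=-1$ for $k=0,\ldots,n$; call this "condition (C)". Then, for every $j=0,\ldots,n$, the specialization $\varepsilon(\omega(\varphi_{2j+1,1}))$ is well defined and satisfies \[ \varepsilon\bigl(\omega(\varphi_{2j+1,1})\bigr)=-1,\qquad \varepsilon\bigl(\omega(\varphi_{2j+1,0})\bigr)=-\varepsilon\bigl(\omega(\alpha_{2j+1})\bigr). \] In other words, the action of $\omega$ on the dependent variables is consistent with condition (C).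
   Context: Fix an integer $n\ge1$. Let $\varphi_{j,i}$ ($j\in\mathbb{Z}_{2n+2}$, $i\in\mathbb{Z}_2$) be independent indeterminates, and let $K=\mathbb{C}(\varphi_{j,i})$. First indices are taken modulo $2n+2$ and second indices modulo $2$. Put $\alpha_j=\varphi_{j,0}\varphi_{j,1}$, $\beta_i=\prod_{j=0}^{2n+1}\varphi_{j,i}$, $\beta'_i=\prod_{j=0}^{2n+1}\varphi_{j,i+j}$, $q=\prod_{j=0}^{2n+1}\alpha_j$, and $\varphi'_{j,i}=\varphi_{-j,i-j}$. Define $Q_{j,i}=\sum_{k=0}^{2n+1}\prod_{l=0}^{k-1}\varphi_{j+l,i}$ and $Q'_{j,i}=\sum_{k=0}^{2n+1}\prod_{l=0}^{k-1}\varphi'_{j+l,i}$. The following field automorphisms of $K$ are given by their values on the generators and are extended as field homomorphisms. - $r_j$ ($j\in\mathbb{Z}_{2n+2}$): $r_j(\varphi_{j-1,i})=\varphi_{j-1,i}\varphi_{j,i+1}\frac{1+\varphi_{j,i}}{1+\varphi_{j,i+1}}$, $r_j(\varphi_{j,i})=\frac{1}{\varphi_{j,i+1}}$, $r_j(\varphi_{j+1,i})=\varphi_{j,i}\varphi_{j+1,i}\frac{1+\varphi_{j,i+1}}{1+\varphi_{j,i}}$, and $r_j(\varphi_{k,i})=\varphi_{k,i}$ for $k\ne j,j\pm1$. - $s_i$ ($i\in\mathbb{Z}_2$): $s_i(\varphi_{j,i})=\frac{1}{\varphi_{j+1,i}}\frac{Q_{j,i}}{Q_{j+2,i}}$ and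 $s_i(\varphi_{j,i+1})=\varphi_{j,i}\varphi_{j,i+1}\varphi_{j+1,i}\frac{Q_{j+2,i}}{Q_{j,i}}$ for all $j$. - $s'_i$ ($i\in\mathbb{Z}_2$): $s'_i(\varphi'_{j,i})=\frac{1}{\varphi'_{j+1,i}}\frac{Q'_{j,i}}{Q'_{j+2,i}}$ and $s'_i(\varphi'_{j,i+1})=\varphi'_{j,i}\varphi'_{j,i+1}\varphi'_{j+1,i}\frac{Q'_{j+2,i}}{Q'_{j,i}}$ for all $j$. - $\pi(\varphi_{j,i})=\varphi_{j+1,i+1}$, $\pi'(\varphi_{j,i})=\varphi_{j+1,i}$, $\rho(\varphi_{j,i})=\varphi'_{j,i}$. Composition is composition of automorphisms: $(\omega_1\omega_2)(f)=\omega_1(\omega_2(f))$. For example, $r_0r_1(\alpha_0)=r_0(\alpha_0\alpha_1)=r_0(\alpha_0)r_0(\alpha_1)=\alpha_1$. Let $\widetilde{G}$ be the group generated by all $r_j,s_i,s'_i,\pi,\pi',\rho$. Define, for $i\in\mathbb{Z}_{n+1}$ (indices of $r$ taken modulo $2n+2$): - $p_i=r_{-2i-3}r_{-2i-2}r_{-2i-3}$ and $p'_i=r_{-2i-4}r_{-2i-3}r_{-2i-4}$; - $\sigma=\pi\,s_0\,r_1r_3\cdots r_{2n+1}$ and $\sigma'=(\pi')^{-1}s'_0\,r_0r_2\cdots r_{2n}$; - $\pi_1=\pi^2$ and $\pi_2=\rho(\pi')^{-1}\pi$. *)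

theory Defs
  imports Complex_Main "HOL-Library.Poly_Mapping" "HOL-Computational_Algebra.Fraction_Field"
begin

text \<open>Multivariate polynomials over C in countably many variables X_0, X_1, ...
  (a monomial is a finitely supported exponent vector nat =>0 nat).
  The variable phi_{j,i} (j in Z_{2n+2}, i in Z_2) is X_{2*(j mod (2n+2)) + (i mod 2)}.
  The remaining variables X_k, k >= 4n+4, are inert (fixed by everything).\<close>

type_synonym mpoly = "(nat \<Rightarrow>\<^sub>0 nat) \<Rightarrow>\<^sub>0 complex"
type_synonym K = "mpoly fract"

definition Xvar :: "nat \<Rightarrow> mpoly" where
  "Xvar k = Poly_Mapping.single (Poly_Mapping.single k 1) 1"

definition cst :: "complex \<Rightarrow> K" where
  "cst c = Fract (Poly_Mapping.single 0 c) 1"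

definition var :: "nat \<Rightarrow> K" where
  "var k = Fract (Xvar k) 1"

definition mpeval :: "(nat \<Rightarrow> K) \<Rightarrow> mpoly \<Rightarrow> K" where
  "mpeval g P = (\<Sum>m\<in>Poly_Mapping.keys P. cst (Poly_Mapping.lookup P m) *
     (\<Prod>k\<in>Poly_Mapping.keys m. g k ^ Poly_Mapping.lookup m k))"

definition subst :: "(nat \<Rightarrow> K) \<Rightarrow> K \<Rightarrow> K" where
  "subst g x = (SOME v. \<exists>p q. q \<noteq> 0 \<and> x = Fract p q \<and> v = mpeval g p / mpeval g q)"

definition N :: "nat \<Rightarrow> int" where "N n = 2 * int n + 2"

definition idx :: "nat \<Rightarrow> int \<Rightarrow> int \<Rightarrow> nat" where
  "idx n j i = nat (2 * (j mod N n) + i mod 2)"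

definition phi :: "nat \<Rightarrow> int \<Rightarrow> int \<Rightarrow> K" where
  "phi n j i = var (idx n j i)"

definition phi' :: "nat \<Rightarrow> int \<Rightarrow> int \<Rightarrow> K" where
  "phi' n j i = phi n (- j) (i - j)"

definition alpha :: "nat \<Rightarrow> int \<Rightarrow> K" where
  "alpha n j = phi n j 0 * phi n j 1"

definition Qf :: "nat \<Rightarrow> int \<Rightarrow> int \<Rightarrow> K" where
  "Qf n j i = (\<Sum>k<2*n+2. \<Prod>l<k. phi n (j + int l) i)"

definition Qf' :: "nat \<Rightarrow> int \<Rightarrow> int \<Rightarrow> K" where
  "Qf' n j i = (\<Sum>k<2*n+2. \<Prod>l<k. phi' n (j + int l) i)"

definition aut :: "nat \<Rightarrow> (int \<Rightarrow> int \<Rightarrow> K) \<Rightarrow> K \<Rightarrow> K" where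
  "aut n F = subst (\<lambda>k. if k < 4*n+4 then F (int (k div 2)) (int (k mod 2)) else var k)"

definition cong2 :: "nat \<Rightarrow> int \<Rightarrow> int \<Rightarrow> bool" where
  "cong2 n a b \<longleftrightarrow> a mod N n = b mod N n"

definition r :: "nat \<Rightarrow> int \<Rightarrow> K \<Rightarrow> K" where
  "r n j = aut n (\<lambda>a i.
     if cong2 n a (j - 1) then
       phi n (j - 1) i * phi n j (i + 1) * (1 + phi n j i) / (1 + phi n j (i + 1))
     else if cong2 n a j then 1 / phi n j (i + 1)
     else if cong2 n a (j + 1) then
       phi n j i * phi n (j + 1) i * (1 + phi n j (i + 1)) / (1 + phi n j i)
     else phi n a i)"

definition s :: "nat \<Rightarrow> int \<Rightarrow> K \<Rightarrow> K" where
  "s n i = aut n (\<lambda>j b.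
     if b mod 2 = i mod 2 then (1 / phi n (j + 1) i) * (Qf n j i / Qf n (j + 2) i)
     else phi n j i * phi n j (i + 1) * phi n (j + 1) i * (Qf n (j + 2) i / Qf n j i))"

text \<open>s'_i is given on the generators phi'_{j,i'}; phi_{a,b} = phi'_{-a, b-a}.\<close>
definition s' :: "nat \<Rightarrow> int \<Rightarrow> K \<Rightarrow> K" where
  "s' n i = aut n (\<lambda>a b. let j = - a; i' = b - a in
     if i' mod 2 = i mod 2 then (1 / phi' n (j + 1) i) * (Qf' n j i / Qf' n (j + 2) i)
     else phi' n j i * phi' n j (i + 1) * phi' n (j + 1) i * (Qf' n (j + 2) i / Qf' n j i))"

definition pi :: "nat \<Rightarrow> K \<Rightarrow> K" where
  "pi n = aut n (\<lambda>j i. phi n (j + 1) (i + 1))"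

definition pi' :: "nat \<Rightarrow> K \<Rightarrow> K" where
  "pi' n = aut n (\<lambda>j i. phi n (j + 1) i)"

definition pi'_inv :: "nat \<Rightarrow> K \<Rightarrow> K" where
  "pi'_inv n = aut n (\<lambda>j i. phi n (j - 1) i)"

definition rho :: "nat \<Rightarrow> K \<Rightarrow> K" where
  "rho n = aut n (\<lambda>j i. phi' n j i)"

definition p :: "nat \<Rightarrow> nat \<Rightarrow> K \<Rightarrow> K" where
  "p n i = r n (- 2 * int i - 3) \<circ> r n (- 2 * int i - 2) \<circ> r n (- 2 * int i - 3)"

definition p' :: "nat \<Rightarrow> nat \<Rightarrow> K \<Rightarrow> K" where
  "p' n i = r n (- 2 * int i - 4) \<circ> r n (- 2 * int i - 3) \<circ> r n (- 2 * int i - 4)"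

definition r_odd :: "nat \<Rightarrow> K \<Rightarrow> K" where
  "r_odd n = foldr (\<circ>) (map (\<lambda>k. r n (2 * int k + 1)) [0..<n+1]) id"

definition r_even :: "nat \<Rightarrow> K \<Rightarrow> K" where
  "r_even n = foldr (\<circ>) (map (\<lambda>k. r n (2 * int k)) [0..<n+1]) id"

definition sigma :: "nat \<Rightarrow> K \<Rightarrow> K" where
  "sigma n = pi n \<circ> s n 0 \<circ> r_odd n"

definition sigma' :: "nat \<Rightarrow> K \<Rightarrow> K" where
  "sigma' n = pi'_inv n \<circ> s' n 0 \<circ> r_even n"

definition pi1 :: "nat \<Rightarrow> K \<Rightarrow> K" where
  "pi1 n = pi n \<circ> pi n"

definition pi2 :: "nat \<Rightarrow> K \<Rightarrow> K" where
  "pi2 n = rho n \<circ> pi'_inv n \<circ> pi n"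

definition omegas :: "nat \<Rightarrow> (K \<Rightarrow> K) set" where
  "omegas n = {p n i | i. i \<le> n} \<union> {p' n i | i. i \<le> n}
              \<union> {sigma n, sigma' n, pi1 n, pi2 n}"

text \<open>Variable phi_{2k+1,1} is X_{4k+3}.\<close>
definition eps_img :: "nat \<Rightarrow> nat \<Rightarrow> K" where
  "eps_img n k = (if k < 4*n+4 \<and> k mod 4 = 3 then -1 else var k)"

text \<open>epsilon(f) is defined iff f = P/Q with epsilon(Q) \<noteq> 0; then epsilon(f) = epsilon(P)/epsilon(Q)
  (independent of the representation).\<close>
definition eps :: "nat \<Rightarrow> K \<Rightarrow> K option" where
  "eps n f = (if \<exists>P Q. f = Fract P Q \<and> mpeval (eps_img n) Q \<noteq> 0
     then Some (SOME v. \<exists>P Q. f = Fract P Q \<and> mpeval (eps_img n) Q \<noteq> 0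
                          \<and> v = mpeval (eps_img n) P / mpeval (eps_img n) Q)
     else None)"

end

theory Submission
  imports Defs
begin

text \<open>A substitution g of the variables extends to a partial homomorphism of K, defined on the local
  ring of fractions P/Q with g(Q) nonzero. The map epsilon is of this kind, and a substitution with
  a left inverse on the variables is injective on polynomials and hence extends to all of K; this
  covers the generators of the group, the reflections being involutions. Nonvanishing of the
  occurring elements of K follows by specializing all variables to 0.

  Every generator of the group maps alpha_j to a Laurent monomial in the alphas, and these
  specialize to nonzero values, so it suffices to show
  that omega(phi_{m,1}) specializes to -1 for odd m. The denominators 1 + phi_{m,1} cancel from
  the rational function r_c r_{c+1} r_c (phi_{m,1}). For sigma the result is
  phi_{m+2,1} Q_{m+3,1} / Q_{m+1,1}, and both sums telescope under epsilon to 1 minus the product of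
  all phi_{k,1}. For sigma' one uses the recursion phi'_{k,i} Q'_{k+1,i} = Q'_{k,i} - (1 - beta), with
  beta the product of all phi'_{k,i}.\<close>

section \<open>Partial specializations of rational functions\<close>

text \<open>Condition (C) is not preserved by the single factors of omega. For c odd, r_c sends
  phi_(c,1) to 1/phi_(c,0), which epsilon leaves alone, and it sends phi_(c+1,1) to a fraction with
  denominator 1 + phi_(c,1), a pole under epsilon. So epsilon cannot be pushed through a composite
  factor by factor: omega(phi_(m,1)) is computed in K as one explicit fraction and specialized only
  after the factors that would become 0 have cancelled. A second obstacle is that
  \<open>subst\<close> picks a representative by choice; what makes it a field homomorphism is the
  algebraic independence of the images of the variables. For r_j, rho and the shifts a left inverse
  is visible at once. For s_i it rests on the formula s_i(Q_(j,i)) = phi_(j,i) Q_(j+1,i) / beta_i,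
  which is \<open>seg_sum_reflect\<close>. The variable phi_(m,0) needs no computation of its own:
  it is alpha_m / phi_(m,1).\<close>

definition meval :: "(nat \<Rightarrow> K) \<Rightarrow> (nat \<Rightarrow>\<^sub>0 nat) \<Rightarrow> K" where
  "meval g m = (\<Prod>k\<in>Poly_Mapping.keys m. g k ^ Poly_Mapping.lookup m k)"

lemma meval_superset:
  assumes "finite A" "Poly_Mapping.keys m \<subseteq> A"
  shows "meval g m = (\<Prod>k\<in>A. g k ^ Poly_Mapping.lookup m k)"
  unfolding meval_def using assms
  by (intro prod.mono_neutral_left) (auto simp: in_keys_iff)

lemma meval_add: "meval g (m + m') = meval g m * meval g m'"
proof -
  let ?A = "Poly_Mapping.keys m \<union> Poly_Mapping.keys m'"
  have "Poly_Mapping.keys (m + m') \<subseteq> ?A"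
    by (rule Poly_Mapping.keys_add)
  then show ?thesis
    by (simp add: meval_superset[of ?A] lookup_add power_add prod.distrib)
qed

lemma cst_add: "cst (a + b) = cst a + cst b"
  by (simp add: cst_def single_add)

lemma cst_mult: "cst (a * b) = cst a * cst b"
  by (simp add: cst_def mult_single)

lemma cst_0 [simp]: "cst 0 = 0"
  by (simp add: cst_def Zero_fract_def)

lemma cst_1 [simp]: "cst 1 = 1"
  by (simp add: cst_def One_fract_def)

lemma mpeval_meval:
  "mpeval g P = (\<Sum>m\<in>Poly_Mapping.keys P. cst (Poly_Mapping.lookup P m) * meval g m)"
  by (simp add: mpeval_def meval_def)

lemma mpeval_superset:
  assumes "finite A" "Poly_Mapping.keys P \<subseteq> A"
  shows "mpeval g P = (\<Sum>m\<in>A. cst (Poly_Mapping.lookup P m) * meval g m)"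
  unfolding mpeval_meval using assms
  by (intro sum.mono_neutral_left) (auto simp: in_keys_iff)

lemma mpeval_add: "mpeval g (P + Q) = mpeval g P + mpeval g Q"
proof -
  let ?A = "Poly_Mapping.keys P \<union> Poly_Mapping.keys Q"
  have "Poly_Mapping.keys (P + Q) \<subseteq> ?A"
    by (rule Poly_Mapping.keys_add)
  then show ?thesis
    by (simp add: mpeval_superset[of ?A] lookup_add cst_add distrib_right sum.distrib)
qed

lemma mpeval_0 [simp]: "mpeval g 0 = 0"
  by (simp add: mpeval_def)

lemma mpeval_single: "mpeval g (Poly_Mapping.single m c) = cst c * meval g m"
  by (simp add: mpeval_meval)

lemma meval_0 [simp]: "meval g 0 = 1"
  by (simp add: meval_def)

lemma mpeval_1 [simp]: "mpeval g 1 = 1"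
  using mpeval_single[of g 0 1] by simp

lemma mpeval_uminus: "mpeval g (- P) = - mpeval g P"
  using mpeval_add[of g P "- P"] by (simp add: eq_neg_iff_add_eq_0 add.commute)

lemma mpeval_sum: "mpeval g (sum f A) = (\<Sum>a\<in>A. mpeval g (f a))"
  by (induction A rule: infinite_finite_induct) (auto simp: mpeval_add)

lemma mpoly_expand:
  "P = (\<Sum>m\<in>Poly_Mapping.keys P. Poly_Mapping.single m (Poly_Mapping.lookup P m))"
  by (rule poly_mapping_eqI) (auto simp: lookup_sum lookup_single when_def in_keys_iff)

lemma mpeval_mult: "mpeval g (P * Q) = mpeval g P * mpeval g Q"
proof -
  have "mpeval g (P * Q) = mpeval g
      ((\<Sum>m\<in>Poly_Mapping.keys P. Poly_Mapping.single m (Poly_Mapping.lookup P m)) *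
       (\<Sum>m\<in>Poly_Mapping.keys Q. Poly_Mapping.single m (Poly_Mapping.lookup Q m)))"
    by (metis mpoly_expand)
  also have "\<dots> = mpeval g P * mpeval g Q"
    by (simp add: sum_product mult_single mpeval_sum mpeval_single mpeval_meval[of g P]
        mpeval_meval[of g Q] meval_add cst_mult mult_ac)
  finally show ?thesis .
qed

lemma mpeval_Xvar [simp]: "mpeval g (Xvar k) = g k"
  by (simp add: Xvar_def mpeval_single meval_def)

text \<open>A relation, since a fraction comes without a preferred representative: every
  representative with surviving denominator yields a value, and \<open>specializes_unique\<close>
  shows that all of them yield the same one.\<close>

definition specializes :: "(nat \<Rightarrow> K) \<Rightarrow> K \<Rightarrow> K \<Rightarrow> bool" where
  "specializes g f v \<longleftrightarrow> (\<exists>P Q. f = Fract P Q \<and> mpeval g Q \<noteq> 0 \<and> v = mpeval g P / mpeval g Q)"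

lemma specializesI:
  "f = Fract P Q \<Longrightarrow> mpeval g Q \<noteq> 0 \<Longrightarrow> v = mpeval g P / mpeval g Q \<Longrightarrow> specializes g f v"
  by (auto simp: specializes_def)

lemma specializesE:
  assumes "specializes g f v"
  obtains P Q where "f = Fract P Q" "mpeval g Q \<noteq> 0" "Q \<noteq> 0" "v = mpeval g P / mpeval g Q"
  using assms unfolding specializes_def by (metis mpeval_0)

lemma specializes_unique:
  assumes "specializes g f v" "specializes g f w"
  shows "v = w"
proof -
  obtain P Q where 1: "f = Fract P Q" "mpeval g Q \<noteq> 0" "Q \<noteq> 0" "v = mpeval g P / mpeval g Q"
    using assms(1) by (rule specializesE)
  obtain P' Q' where 2: "f = Fract P' Q'" "mpeval g Q' \<noteq> 0" "Q' \<noteq> 0" "w = mpeval g P' / mpeval g Q'"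
    using assms(2) by (rule specializesE)
  have "P * Q' = P' * Q"
    using 1 2 by (simp add: eq_fract)
  then have "mpeval g P * mpeval g Q' = mpeval g P' * mpeval g Q"
    by (metis mpeval_mult)
  then show ?thesis
    using 1 2 by (simp add: frac_eq_eq)
qed

lemma specializes_0 [simp, intro]: "specializes g 0 0"
  by (rule specializesI[OF Zero_fract_def]) auto

lemma specializes_1 [simp, intro]: "specializes g 1 1"
  by (rule specializesI[OF One_fract_def]) auto

lemma specializes_var: "specializes g (var k) (g k)"
  by (rule specializesI[of _ "Xvar k" 1]) (auto simp: var_def)

lemma specializes_cst: "specializes g (cst c) (cst c)"
  by (rule specializesI[of _ "Poly_Mapping.single 0 c" 1]) (auto simp: cst_def mpeval_single)

lemma specializes_add:
  assumes "specializes g a v" "specializes g b w"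
  shows "specializes g (a + b) (v + w)"
proof -
  obtain P Q where 1: "a = Fract P Q" "mpeval g Q \<noteq> 0" "Q \<noteq> 0" "v = mpeval g P / mpeval g Q"
    using assms(1) by (rule specializesE)
  obtain P' Q' where 2: "b = Fract P' Q'" "mpeval g Q' \<noteq> 0" "Q' \<noteq> 0" "w = mpeval g P' / mpeval g Q'"
    using assms(2) by (rule specializesE)
  show ?thesis
    by (rule specializesI[of _ "P * Q' + P' * Q" "Q * Q'"])
      (use 1 2 in \<open>auto simp: mpeval_mult mpeval_add add_frac_eq\<close>)
qed

lemma specializes_mult:
  assumes "specializes g a v" "specializes g b w"
  shows "specializes g (a * b) (v * w)"
proof -
  obtain P Q where 1: "a = Fract P Q" "mpeval g Q \<noteq> 0" "Q \<noteq> 0" "v = mpeval g P / mpeval g Q"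
    using assms(1) by (rule specializesE)
  obtain P' Q' where 2: "b = Fract P' Q'" "mpeval g Q' \<noteq> 0" "Q' \<noteq> 0" "w = mpeval g P' / mpeval g Q'"
    using assms(2) by (rule specializesE)
  show ?thesis
    by (rule specializesI[of _ "P * P'" "Q * Q'"])
      (use 1 2 in \<open>auto simp: mpeval_mult\<close>)
qed

lemma specializes_uminus:
  assumes "specializes g a v"
  shows "specializes g (- a) (- v)"
proof -
  obtain P Q where 1: "a = Fract P Q" "mpeval g Q \<noteq> 0" "Q \<noteq> 0" "v = mpeval g P / mpeval g Q"
    using assms(1) by (rule specializesE)
  show ?thesis
    by (rule specializesI[of _ "- P" Q]) (use 1 in \<open>auto simp: mpeval_uminus\<close>)
qed

lemma specializes_diff:
  "specializes g a v \<Longrightarrow> specializes g b w \<Longrightarrow> specializes g (a - b) (v - w)"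
  using specializes_add[of g a v "- b" "- w"] specializes_uminus[of g b w] by simp

lemma specializes_inverse:
  assumes "specializes g a v" "v \<noteq> 0"
  shows "specializes g (inverse a) (inverse v)"
proof -
  obtain P Q where 1: "a = Fract P Q" "mpeval g Q \<noteq> 0" "Q \<noteq> 0" "v = mpeval g P / mpeval g Q"
    using assms(1) by (rule specializesE)
  show ?thesis
    by (rule specializesI[of _ Q P]) (use 1 assms(2) in auto)
qed

lemma specializes_divide:
  "specializes g a v \<Longrightarrow> specializes g b w \<Longrightarrow> w \<noteq> 0 \<Longrightarrow> specializes g (a / b) (v / w)"
  unfolding divide_inverse by (intro specializes_mult specializes_inverse)

lemma specializes_sum:
  "(\<And>x. x \<in> A \<Longrightarrow> specializes g (f x) (h x)) \<Longrightarrow> specializes g (sum f A) (sum h A)"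
  by (induction A rule: infinite_finite_induct) (auto intro: specializes_add)

lemma specializes_prod:
  "(\<And>x. x \<in> A \<Longrightarrow> specializes g (f x) (h x)) \<Longrightarrow> specializes g (prod f A) (prod h A)"
  by (induction A rule: infinite_finite_induct) (auto intro: specializes_mult)

lemma specializes_power:
  "specializes g a v \<Longrightarrow> specializes g (a ^ m) (v ^ m)"
  by (induction m) (auto intro: specializes_mult)

lemmas specializes_intros =
  specializes_add specializes_mult specializes_diff specializes_uminus specializes_divide
  specializes_sum specializes_prod specializes_0 specializes_1

lemma specializes_nonzero: "specializes g f v \<Longrightarrow> v \<noteq> 0 \<Longrightarrow> f \<noteq> 0"
  using specializes_unique[OF specializes_0] by blast

text \<open>By uniqueness the choice in \<open>eps\<close> is forced, so that deriving
  \<open>specializes\<close> amounts to computing \<open>eps\<close>.\<close>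

lemma eps_eqI:
  assumes "specializes (eps_img n) f v"
  shows "eps n f = Some v"
proof -
  have "(SOME v. specializes (eps_img n) f v) = v"
    by (rule some_equality) (use assms specializes_unique in blast)+
  then show ?thesis
    using assms unfolding eps_def specializes_def by auto
qed

text \<open>Algebraic independence of the g k over the constants. No nonzero denominator is killed,
  so \<open>specializes g\<close> becomes total on K.\<close>

definition faithful :: "(nat \<Rightarrow> K) \<Rightarrow> bool" where
  "faithful g \<longleftrightarrow> (\<forall>P. P \<noteq> 0 \<longrightarrow> mpeval g P \<noteq> 0)"

text \<open>Checked on monomials and extended linearly. It identifies P(h(g)) with P in the
  left-inverse argument of \<open>faithfulI\<close>.\<close>

lemma mpeval_var: "mpeval var P = Fract P 1"
proof -
  have mult1: "Fract (a * b) 1 = Fract a 1 * Fract b 1"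
    and add1: "Fract (a + b) 1 = Fract a 1 + Fract b 1" for a b :: mpoly
    by simp_all
  have pow: "Fract (Q ^ m) 1 = Fract Q 1 ^ m" for Q :: mpoly and m :: nat
    by (induction m) (simp_all add: mult1 One_fract_def[symmetric] del: mult_fract)
  have hprod: "Fract (prod f A) 1 = (\<Prod>a\<in>A. Fract (f a) 1)" for f :: "nat \<Rightarrow> mpoly" and A
    by (induction A rule: infinite_finite_induct)
      (simp_all add: mult1 One_fract_def[symmetric] del: mult_fract)
  have hsum: "Fract (sum f A) 1 = (\<Sum>a\<in>A. Fract (f a) 1)" for f :: "(nat \<Rightarrow>\<^sub>0 nat) \<Rightarrow> mpoly" and A
    by (induction A rule: infinite_finite_induct)
      (simp_all add: add1 Zero_fract_def[symmetric] del: add_fract)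
  have Xpow: "Xvar k ^ e = Poly_Mapping.single (Poly_Mapping.single k e) 1" for k e
    by (induction e) (auto simp: Xvar_def mult_single single_add[symmetric])
  have sprod: "(\<Prod>k\<in>A. Poly_Mapping.single (f k) 1) =
      (Poly_Mapping.single (\<Sum>k\<in>A. f k) 1 :: mpoly)" for f :: "nat \<Rightarrow> nat \<Rightarrow>\<^sub>0 nat" and A
    by (induction A rule: infinite_finite_induct) (auto simp: mult_single)
  have mexp: "(\<Sum>k\<in>Poly_Mapping.keys m. Poly_Mapping.single k (Poly_Mapping.lookup m k)) = m"
    for m :: "nat \<Rightarrow>\<^sub>0 nat"
    by (rule poly_mapping_eqI) (auto simp: lookup_sum lookup_single when_def in_keys_iff)
  have mono: "meval var m = Fract (Poly_Mapping.single m 1) 1" for m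
    by (simp add: meval_def var_def pow[symmetric] hprod[symmetric] Xpow sprod mexp)
  have "Fract P 1 =
      Fract (\<Sum>m\<in>Poly_Mapping.keys P. Poly_Mapping.single m (Poly_Mapping.lookup P m)) 1"
    by (metis mpoly_expand)
  also have "\<dots> = mpeval var P"
    by (simp add: mpeval_meval mono cst_def mult_single hsum)
  finally show ?thesis by simp
qed

text \<open>Applying a left inverse h to a vanishing P(g) gives P = P(h(g)) = h(0) = 0.\<close>
lemma faithfulI:
  assumes "\<And>k. specializes h (g k) (var k)"
  shows "faithful g"
  unfolding faithful_def
proof (intro allI impI notI)
  fix P assume "P \<noteq> 0" "mpeval g P = 0"
  have "specializes h (mpeval g P) (mpeval var P)"
    unfolding mpeval_def
    by (intro specializes_sum specializes_mult specializes_cst specializes_prod specializes_power assms)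
  then have "Fract P 1 = 0"
    using \<open>mpeval g P = 0\<close> specializes_unique specializes_0 by (metis mpeval_var)
  then show False
    using \<open>P \<noteq> 0\<close> by (simp add: Zero_fract_def eq_fract)
qed

text \<open>\<open>subst\<close> asks for q \<noteq> 0 and \<open>specializes\<close> for g(q)
  \<noteq> 0. Faithfulness makes these conditions equivalent, and uniqueness then forces the
  choice.\<close>

lemma subst_eqI:
  assumes "faithful g" "specializes g f v"
  shows "subst g f = v"
proof -
  have *: "(\<exists>P Q. Q \<noteq> 0 \<and> f = Fract P Q \<and> v = mpeval g P / mpeval g Q) \<longleftrightarrow> specializes g f v" for v
    using assms(1) unfolding faithful_def specializes_def by (metis mpeval_0)
  show ?thesis
    unfolding subst_def * using assms(2) specializes_unique by blast
qed

lemma specializes_subst: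
  assumes "faithful g"
  shows "specializes g f (subst g f)"
proof -
  obtain P Q where "f = Fract P Q" "Q \<noteq> 0" by (cases f)
  then have "specializes g f (mpeval g P / mpeval g Q)"
    using assms by (auto simp: faithful_def intro!: specializesI)
  then show ?thesis
    using subst_eqI[OF assms] by metis
qed

definition field_hom :: "(K \<Rightarrow> K) \<Rightarrow> bool" where
  "field_hom f \<longleftrightarrow> f 1 = 1 \<and> (\<forall>a b. f (a + b) = f a + f b) \<and> (\<forall>a b. f (a * b) = f a * f b)"

lemma field_hom_add: "field_hom f \<Longrightarrow> f (a + b) = f a + f b"
  and field_hom_mult: "field_hom f \<Longrightarrow> f (a * b) = f a * f b"
  and field_hom_1: "field_hom f \<Longrightarrow> f 1 = 1"
  by (auto simp: field_hom_def)

lemma field_hom_0: "field_hom f \<Longrightarrow> f 0 = 0"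
  using field_hom_add[of f 0 0] by (metis add_cancel_right_right)

lemma field_hom_inverse: "field_hom f \<Longrightarrow> f (inverse a) = inverse (f a)"
  by (cases "a = 0") (auto simp: field_hom_0 field_hom_1 field_hom_mult[symmetric] intro!: inverse_unique[symmetric])

lemma field_hom_divide: "field_hom f \<Longrightarrow> f (a / b) = f a / f b"
  by (simp add: divide_inverse field_hom_mult field_hom_inverse)

lemma field_hom_sum: "field_hom f \<Longrightarrow> f (sum h A) = (\<Sum>x\<in>A. f (h x))"
  by (induction A rule: infinite_finite_induct) (auto simp: field_hom_0 field_hom_add)

lemma field_hom_prod: "field_hom f \<Longrightarrow> f (prod h A) = (\<Prod>x\<in>A. f (h x))"
  by (induction A rule: infinite_finite_induct) (auto simp: field_hom_1 field_hom_mult)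

lemmas field_hom_simps = field_hom_add field_hom_mult field_hom_1 field_hom_0 field_hom_divide
  field_hom_sum field_hom_prod

lemma field_hom_subst: "faithful g \<Longrightarrow> field_hom (subst g)"
  unfolding field_hom_def
  by (auto intro!: subst_eqI specializes_add specializes_mult specializes_subst)

lemma field_hom_comp: "field_hom f \<Longrightarrow> field_hom h \<Longrightarrow> field_hom (f \<circ> h)"
  by (simp add: field_hom_def)

lemma field_hom_id: "field_hom id"
  by (simp add: field_hom_def)

section \<open>Cyclic sums\<close>

text \<open>Partial products and their sums are taken for an arbitrary sequence x, so that the same
  identities serve phi_(.,i), phi'_(.,i), their images under s_i and s'_i, and their
  specializations.\<close>

definition seg_prod :: "nat \<Rightarrow> (int \<Rightarrow> 'a::field) \<Rightarrow> int \<Rightarrow> 'a" where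
  "seg_prod m x j = (\<Prod>l<m. x (j + int l))"

definition seg_sum :: "nat \<Rightarrow> (int \<Rightarrow> 'a::field) \<Rightarrow> int \<Rightarrow> 'a" where
  "seg_sum m x j = (\<Sum>k<m. seg_prod k x j)"

lemma seg_prod_0 [simp]: "seg_prod 0 x j = 1"
  by (simp add: seg_prod_def)

lemma seg_prod_Suc: "seg_prod (Suc k) x j = seg_prod k x j * x (j + int k)"
  by (simp add: seg_prod_def)

lemma seg_prod_Suc_shift: "seg_prod (Suc k) x j = x j * seg_prod k x (j + 1)"
  unfolding seg_prod_def prod.lessThan_Suc_shift by (simp add: add.assoc o_def)

text \<open>Moving the window by one trades the factor x_j for x_(j+m), which is equal to it by
  periodicity.\<close>

lemma seg_prod_shift_1:
  assumes "\<And>j. x (j + int m) = x j"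
  shows "seg_prod m x (j + 1) = seg_prod m x j"
proof (cases m)
  case (Suc k)
  have "x (j + 1 + int k) = x j"
    using assms[of j] Suc by (simp add: add_ac)
  then show ?thesis
    using seg_prod_Suc[of k x "j + 1"] seg_prod_Suc_shift[of k x j] Suc by simp
qed simp

lemma seg_prod_shift:
  assumes "\<And>j. x (j + int m) = x j"
  shows "seg_prod m x j = seg_prod m x 0"
proof (induction j rule: int_induct[where k = 0])
  case (step1 i)
  then show ?case using seg_prod_shift_1[where x = x and m = m, OF assms] by simp
next
  case (step2 i)
  then show ?case using seg_prod_shift_1[where x = x and m = m and j = "i - 1", OF assms] by simp
qed simp

text \<open>Multiplication by x_j turns each partial product from j + 1 into the next longer one
  from j. The sum loses its leading 1 and gains the product over a full period.\<close>

lemma seg_sum_rec: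
  assumes "\<And>j. x (j + int m) = x j"
  shows "x j * seg_sum m x (j + 1) = seg_sum m x j - (1 - seg_prod m x 0)"
proof -
  have "x j * seg_sum m x (j + 1) = (\<Sum>k<m. seg_prod (Suc k) x j)"
    by (simp add: seg_sum_def sum_distrib_left seg_prod_Suc_shift)
  also have "1 + \<dots> = (\<Sum>k<Suc m. seg_prod k x j)"
    unfolding sum.lessThan_Suc_shift by simp
  also have "\<dots> = seg_sum m x j + seg_prod m x 0"
    using seg_prod_shift[where x = x and m = m, OF assms] by (simp add: seg_sum_def)
  finally show ?thesis by (simp add: algebra_simps)
qed

lemma seg_sum_shift:
  assumes "\<And>j. x (j + int m) = x j"
  shows "seg_sum m x (j + int m) = seg_sum m x j"
proof -
  have "x (j + int m + int l) = x (j + int l)" for l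
    using assms[of "j + int l"] by (simp add: add_ac)
  then show ?thesis by (simp add: seg_sum_def seg_prod_def)
qed

text \<open>With X the image of x under s_i, this computes s_i(Q_j). The products of the X telescope
  because Q_i / Q_(i+2) is a quotient of consecutive values of Q_i Q_(i+1). The sum telescopes after
  multiplication by 1 - B, B the full product: the recursion writes 1 - B as Q_i - x_i Q_(i+1),
  which splits each summand into a difference.\<close>

lemma seg_sum_reflect:
  fixes x :: "int \<Rightarrow> 'a::field"
  assumes per: "\<And>j. x (j + int m) = x j"
    and x: "\<And>j. x j \<noteq> 0" and Q: "\<And>j. seg_sum m x j \<noteq> 0" and d: "seg_prod m x 0 \<noteq> 1"
  defines "X \<equiv> \<lambda>j. 1 / x (j + 1) * (seg_sum m x j / seg_sum m x (j + 2))"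
  shows "seg_sum m X j = x j * seg_sum m x (j + 1) / seg_prod m x 0"
proof -
  let ?Q = "seg_sum m x" and ?d = "1 - seg_prod m x 0"
  have cp: "seg_prod k x i \<noteq> 0" for k i
    by (simp add: seg_prod_def x)
  \<comment> \<open>The factor \<open>x j\<close> compensates for writing x_(j+1) ... x_(j+k) as the
    product of the k + 1 factors that start at j.\<close>
  have prodX: "seg_prod k X j = ?Q j * ?Q (j + 1) * x j /
      (?Q (j + int k) * ?Q (j + int k + 1) * seg_prod (Suc k) x j)" for k
  proof (induction k)
    case 0
    then show ?case using x Q by (simp add: seg_prod_Suc)
  next
    case (Suc k)
    have e: "j + int (Suc k) = j + int k + 1" "j + int k + 1 + 1 = j + int k + 2"
      by simp_all
    have X: "X (j + int k) = 1 / x (j + int k + 1) * (?Q (j + int k) / ?Q (j + int k + 2))"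
      by (simp add: X_def)
    have "seg_prod (Suc k) X j = seg_prod k X j * X (j + int k)"
      by (rule seg_prod_Suc)
    also have "\<dots> = ?Q j * ?Q (j + 1) * x j /
        (?Q (j + int (Suc k)) * ?Q (j + int (Suc k) + 1) * seg_prod (Suc (Suc k)) x j)"
      unfolding Suc X seg_prod_Suc[of "Suc k" x] e
      using x Q cp by (simp add: e mult_ac)
    finally show ?case .
  qed
  \<comment> \<open>The bracket is the telescoped sum; it vanishes at k = 0.\<close>
  have sumX: "?d * seg_sum k X j = ?Q j * ?Q (j + 1) * x j * (1 / (seg_prod k x j * ?Q (j + int k)) - 1 / ?Q j)" for k
  proof (induction k)
    case 0
    then show ?case by (simp add: seg_sum_def)
  next
    case (Suc k)
    have rec: "?d = ?Q (j + int k) - x (j + int k) * ?Q (j + int k + 1)"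
      using seg_sum_rec[where x = x and m = m, OF per, where j = "j + int k"] by simp
    have e: "j + int (Suc k) = j + int k + 1" by simp
    have "?d * seg_sum (Suc k) X j = ?d * seg_sum k X j + ?d * seg_prod k X j"
      by (simp add: seg_sum_def algebra_simps)
    also have "\<dots> = ?Q j * ?Q (j + 1) * x j * (1 / (seg_prod k x j * ?Q (j + int k)) - 1 / ?Q j
        + (?Q (j + int k) - x (j + int k) * ?Q (j + int k + 1)) /
          (?Q (j + int k) * ?Q (j + int k + 1) * (seg_prod k x j * x (j + int k))))"
      unfolding Suc prodX rec[symmetric] seg_prod_Suc by (simp add: algebra_simps)
    also have "1 / (seg_prod k x j * ?Q (j + int k)) - 1 / ?Q j
        + (?Q (j + int k) - x (j + int k) * ?Q (j + int k + 1)) /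
          (?Q (j + int k) * ?Q (j + int k + 1) * (seg_prod k x j * x (j + int k)))
        = 1 / (seg_prod (Suc k) x j * ?Q (j + int (Suc k))) - 1 / ?Q j"
      unfolding seg_prod_Suc e using x[of "j + int k"] Q[of "j + int k"] Q[of "j + int k + 1"] cp[of k j]
      by (simp add: field_simps)
    finally show ?case .
  qed
  \<comment> \<open>At k = m the product is B and Q_(j+m) = Q_j, so the bracket becomes (1 - B) / (B
    Q_j) and 1 - B appears on both sides.\<close>
  have "?d * seg_sum m X j = ?d * (x j * ?Q (j + 1) / seg_prod m x 0)"
    unfolding sumX[of m] seg_prod_shift[where x = x and m = m and j = j, OF per]
      seg_sum_shift[where x = x and m = m, OF per]
    using Q[of j] cp[of m 0] by (simp add: field_simps)
  moreover have "?d \<noteq> 0"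
    using d by simp
  ultimately show ?thesis
    using mult_left_cancel by blast
qed

section \<open>The generators of the group\<close>

lemma N_pos [simp]: "N n > 0" and even_N [simp]: "even (N n)"
  and N_int: "N n = int (2 * n + 2)"
  by (auto simp: N_def)

text \<open>Well-definedness of F on Z_(2n+2) x Z_2. \<open>aut\<close> reads F only at the standard
  representatives; periodicity carries the result to all integer indices.\<close>

definition periodic :: "nat \<Rightarrow> (int \<Rightarrow> int \<Rightarrow> 'a) \<Rightarrow> bool" where
  "periodic n F \<longleftrightarrow> (\<forall>j i j' i'. cong2 n j j' \<longrightarrow> i mod 2 = i' mod 2 \<longrightarrow> F j i = F j' i')"

lemma periodicD: "periodic n F \<Longrightarrow> cong2 n j j' \<Longrightarrow> i mod 2 = i' mod 2 \<Longrightarrow> F j i = F j' i'"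
  by (auto simp: periodic_def)

lemma cong2_iff: "cong2 n a b \<longleftrightarrow> N n dvd a - b"
  by (simp add: cong2_def mod_eq_dvd_iff)

lemma cong2_refl [simp]: "cong2 n a a"
  by (simp add: cong2_def)

lemma cong2_sym: "cong2 n a b \<Longrightarrow> cong2 n b a"
  by (simp add: cong2_def)

lemma cong2_trans: "cong2 n a b \<Longrightarrow> cong2 n b c \<Longrightarrow> cong2 n a c"
  by (simp add: cong2_def)

lemma cong2_mod: "cong2 n (a mod N n) a"
  by (simp add: cong2_def)

lemma cong2_parity: "cong2 n a b \<Longrightarrow> even a \<longleftrightarrow> even b"
proof -
  assume "cong2 n a b"
  then have "2 dvd a - b"
    using even_N dvd_trans unfolding cong2_iff by blast
  then show "even a \<longleftrightarrow> even b" by presburger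
qed

lemma not_cong2:
  assumes "a \<noteq> b" "\<bar>a - b\<bar> < N n"
  shows "\<not> cong2 n a b"
  using assms zdvd_imp_le[of "N n" "\<bar>a - b\<bar>"] by (auto simp: cong2_iff)

lemma cong2_add: "cong2 n a b \<Longrightarrow> cong2 n (a + c) (b + c)"
  by (simp add: cong2_iff)

lemma cong2_minus: "cong2 n a b \<Longrightarrow> cong2 n (- a) (- b)"
  by (simp add: cong2_iff dvd_diff_commute)

lemma cong2_shift_N: "cong2 n (j + int (2 * n + 2)) j"
  by (simp add: cong2_iff N_int)

lemma periodic_phi: "periodic n (phi n)"
  by (auto simp: periodic_def phi_def idx_def cong2_def)

text \<open>The second index i - j makes sense modulo 2 because the modulus 2n + 2 of j is
  even.\<close>

lemma periodic_phi': "periodic n (phi' n)"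
  unfolding periodic_def phi'_def
proof (intro allI impI)
  fix j i j' i' assume "cong2 n j j'" "i mod 2 = i' mod (2::int)"
  moreover from this have "(i - j) mod 2 = (i' - j') mod 2"
    using cong2_parity[of n j j'] by presburger
  ultimately show "phi n (- j) (i - j) = phi n (- j') (i' - j')"
    by (intro periodicD[OF periodic_phi] cong2_minus)
qed

definition assignment :: "nat \<Rightarrow> (int \<Rightarrow> int \<Rightarrow> K) \<Rightarrow> nat \<Rightarrow> K" where
  "assignment n F k = (if k < 4*n+4 then F (int (k div 2)) (int (k mod 2)) else var k)"

lemma aut_assignment: "aut n F = subst (assignment n F)"
  by (simp add: aut_def assignment_def[abs_def])

lemma int_idx: "int (idx n j i) = 2 * (j mod N n) + i mod 2"
  by (simp add: idx_def)

lemma idx_less: "idx n j i < 4 * n + 4"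
proof -
  have "j mod N n < N n" "i mod 2 < 2" by simp_all
  then have "2 * (j mod N n) + i mod 2 < 2 * N n" by linarith
  then have "int (idx n j i) < int (4 * n + 4)"
    unfolding int_idx by (simp add: N_def)
  then show ?thesis by linarith
qed

lemma idx_div: "int (idx n j i div 2) = j mod N n"
  by (simp add: zdiv_int int_idx)

lemma idx_mod: "int (idx n j i mod 2) = i mod 2"
  by (simp add: zmod_int int_idx)

lemma specializes_assignment:
  assumes "periodic n F"
  shows "specializes (assignment n F) (phi n j i) (F j i)"
proof -
  have "assignment n F (idx n j i) = F j i"
    using idx_less[of n j i] periodicD[OF assms cong2_mod] by (simp add: assignment_def idx_div idx_mod)
  then show ?thesis
    using specializes_var[of "assignment n F" "idx n j i"] by (simp only: phi_def)
qed

lemma var_phi: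
  assumes "k < 4 * n + 4"
  shows "phi n (int (k div 2)) (int (k mod 2)) = var k"
proof -
  have "int (k div 2) mod N n = int (k div 2)"
    using assms by (intro mod_pos_pos_trivial) (auto simp: N_def)
  moreover have "2 * int (k div 2) + int (k mod 2) = int k"
    by presburger
  ultimately show ?thesis
    by (simp add: phi_def idx_def nat_int del: of_nat_mod of_nat_div)
qed

text \<open>G is the candidate for the left inverse. It has to be checked on the phi only, since
  both assignments fix the inert variables.\<close>

lemma faithful_assignment:
  assumes "\<And>j i. specializes (assignment n G) (F j i) (phi n j i)"
  shows "faithful (assignment n F)"
proof (rule faithfulI)
  fix k
  show "specializes (assignment n G) (assignment n F k) (var k)"
  proof (cases "k < 4 * n + 4")
    case True
    then show ?thesis
      using assms[of "int (k div 2)" "int (k mod 2)"] by (simp only: assignment_def var_phi if_True)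
  next
    case False
    then show ?thesis
      using specializes_var[of "assignment n G" k] by (simp add: assignment_def)
  qed
qed

lemma aut_phi:
  assumes "faithful (assignment n F)" "periodic n F"
  shows "aut n F (phi n j i) = F j i"
  unfolding aut_assignment using assms by (intro subst_eqI specializes_assignment)

lemma field_hom_aut: "faithful (assignment n F) \<Longrightarrow> field_hom (aut n F)"
  unfolding aut_assignment by (rule field_hom_subst)

lemma specializes_eps_phi:
  "specializes (eps_img n) (phi n j i) (if odd j \<and> odd i then - 1 else phi n j i)"
proof -
  \<comment> \<open>The index is 2 j + i on representatives, and reducing j modulo the even number
    2n + 2 keeps its parity.\<close>
  have "idx n j i mod 4 = 3 \<longleftrightarrow> odd j \<and> odd i"
  proof -
    have "odd j \<longleftrightarrow> odd (j mod N n)"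
      using cong2_parity[OF cong2_mod] by blast
    moreover have "int (idx n j i mod 4) = (2 * (j mod N n) + i mod 2) mod 4"
      by (simp add: zmod_int int_idx)
    moreover have "(2 * t + i mod 2) mod 4 = 3 \<longleftrightarrow> odd t \<and> odd i" for t
      by presburger
    moreover have "idx n j i mod 4 = 3 \<longleftrightarrow> int (idx n j i mod 4) = 3"
      by linarith
    ultimately show ?thesis
      by simp
  qed
  then have "eps_img n (idx n j i) = (if odd j \<and> odd i then - 1 else phi n j i)"
    using idx_less[of n j i] by (simp add: eps_img_def phi_def)
  then show ?thesis
    using specializes_var[of "eps_img n" "idx n j i"] by (simp only: phi_def)
qed

lemma specializes_zero_phi: "specializes (\<lambda>_. 0) (phi n j i) 0"
  unfolding phi_def by (rule specializes_var)

lemma specializes_zero_phi': "specializes (\<lambda>_. 0) (phi' n j i) 0"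
  unfolding phi'_def by (rule specializes_zero_phi)

text \<open>A variable vanishes at the origin, so the witness is the point with all coordinates
  1.\<close>

lemma var_nonzero: "var k \<noteq> 0"
  by (rule specializes_nonzero[where g = "\<lambda>_. 1", OF specializes_var]) simp

lemma phi_nonzero [simp]: "phi n j i \<noteq> 0"
  by (simp add: phi_def var_nonzero)

lemma phi'_nonzero [simp]: "phi' n j i \<noteq> 0"
  by (simp add: phi'_def)

lemma specializes_zero_seg_prod:
  assumes "\<And>j. specializes (\<lambda>_. 0) (x j) 0"
  shows "specializes (\<lambda>_. 0) (seg_prod k x j) (if k = 0 then 1 else 0)"
proof -
  have "specializes (\<lambda>_. 0) (seg_prod k x j) (\<Prod>l<k. 0)"
    unfolding seg_prod_def by (intro specializes_prod assms)
  also have "(\<Prod>l<k. 0) = (if k = 0 then 1 else 0 :: K)"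
    by auto
  finally show ?thesis .
qed

text \<open>Only the empty product survives at the origin.\<close>

lemma specializes_zero_seg_sum:
  assumes "\<And>j. specializes (\<lambda>_. 0) (x j) 0" "m > 0"
  shows "specializes (\<lambda>_. 0) (seg_sum m x j) 1"
proof -
  have "specializes (\<lambda>_. 0) (seg_sum m x j) (\<Sum>k<m. if k = 0 then 1 else 0)"
    unfolding seg_sum_def by (intro specializes_sum specializes_zero_seg_prod assms)
  also have "(\<Sum>k<m. if k = 0 then 1 else 0 :: K) = 1"
    using assms(2) by (simp add: sum.delta)
  finally show ?thesis .
qed

lemma seg_sum_nonzero:
  assumes "\<And>j. specializes (\<lambda>_. 0) (x j) 0" "m > 0"
  shows "seg_sum m x j \<noteq> 0"
  by (rule specializes_nonzero[OF specializes_zero_seg_sum]) (use assms in auto)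

lemma seg_prod_neq_1:
  assumes "\<And>j. specializes (\<lambda>_. 0) (x j) 0" "m > 0"
  shows "seg_prod m x j \<noteq> 1"
proof
  assume "seg_prod m x j = 1"
  then have "specializes (\<lambda>_. 0) 1 0"
    using specializes_zero_seg_prod[where x = x and k = m and j = j, OF assms(1)] assms(2) by simp
  then show False
    using specializes_unique[OF specializes_1] by force
qed

lemma one_plus_nonzero: "specializes (\<lambda>_. 0) a 0 \<Longrightarrow> 1 + a \<noteq> 0"
  using specializes_nonzero[OF specializes_add[OF specializes_1, of "\<lambda>_. 0" a 0]] by simp

lemma one_plus_phi_nonzero [simp]: "1 + phi n j i \<noteq> 0" "phi n j i + 1 \<noteq> 0"
  using one_plus_nonzero[OF specializes_zero_phi] by (simp_all add: add.commute)

text \<open>Taking \<psi> = phi gives s_i, and \<psi> = phi' gives s'_i.\<close>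

definition s_image :: "nat \<Rightarrow> (int \<Rightarrow> int \<Rightarrow> K) \<Rightarrow> int \<Rightarrow> int \<Rightarrow> int \<Rightarrow> K" where
  "s_image n \<psi> i j b = (let Q = seg_sum (2*n+2) (\<lambda>m. \<psi> m i) in
     if b mod 2 = i mod 2 then (1 / \<psi> (j + 1) i) * (Q j / Q (j + 2))
     else \<psi> j i * \<psi> j (i + 1) * \<psi> (j + 1) i * (Q (j + 2) / Q j))"

lemma periodic_s_image:
  assumes "periodic n \<psi>"
  shows "periodic n (s_image n \<psi> i)"
  unfolding periodic_def
proof (intro allI impI)
  fix j b j' b' assume c: "cong2 n j j'" and b: "b mod 2 = b' mod (2::int)"
  have *: "\<psi> (j + k) l = \<psi> (j' + k) l" for k l
    by (intro periodicD[OF assms] cong2_add c refl)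
  then have "seg_sum (2*n+2) (\<lambda>m. \<psi> m i) (j + k) = seg_sum (2*n+2) (\<lambda>m. \<psi> m i) (j' + k)" for k
    by (simp add: seg_sum_def seg_prod_def add.assoc)
  from this[of 0] this[of 2] *[of 0] *[of 1]
  show "s_image n \<psi> i j b = s_image n \<psi> i j' b'"
    by (simp add: s_image_def Let_def b)
qed

text \<open>The substitution g is kept abstract because s'_i is an assignment of the phi and not of
  the phi' in which its formula is written. By \<open>seg_sum_reflect\<close>, Q_j goes to x_j
  Q_(j+1) / B; in the ratio Q_j / Q_(j+2) the B cancels, and the remaining factors undo those of
  X.\<close>

lemma s_image_involution:
  assumes per: "periodic n \<psi>" and zero: "\<And>j b. specializes (\<lambda>_. 0) (\<psi> j b) 0"
    and nz: "\<And>j b. \<psi> j b \<noteq> 0"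
    and g: "\<And>j b. specializes g (\<psi> j b) (s_image n \<psi> i j b)"
  shows "specializes g (s_image n \<psi> i j b) (\<psi> j b)"
proof -
  define x y Q where "x j = \<psi> j i" and "y j = \<psi> j (i + 1)" and "Q j = seg_sum (2*n+2) x j" for j
  define X where "X j = 1 / x (j + 1) * (Q j / Q (j + 2))" for j
  define B where "B = seg_prod (2*n+2) x 0"
  have perx: "x (j + int (2 * n + 2)) = x j" for j
    unfolding x_def by (rule periodicD[OF per cong2_shift_N refl])
  have zx: "specializes (\<lambda>_. 0) (x j) 0" for j
    unfolding x_def by (rule zero)
  have Qnz: "Q j \<noteq> 0" for j
    unfolding Q_def by (rule seg_sum_nonzero[OF zx]) simp
  have xnz: "x j \<noteq> 0" for j
    by (simp add: x_def nz)
  have Bnz: "B \<noteq> 0"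
    by (simp add: B_def seg_prod_def xnz)
  have xX: "specializes g (x j) (X j)" for j
    using g[of j i] by (simp add: x_def[abs_def] X_def s_image_def Q_def[abs_def] Let_def)
  have yY: "specializes g (y j) (x j * y j * x (j + 1) * (Q (j + 2) / Q j))" for j
  proof -
    have "(i + 1) mod 2 \<noteq> i mod 2" by presburger
    then show ?thesis
      using g[of j "i + 1"] by (simp add: x_def[abs_def] y_def s_image_def Q_def[abs_def] Let_def)
  qed
  have "specializes g (Q j) (seg_sum (2*n+2) X j)" for j
    unfolding Q_def seg_sum_def seg_prod_def by (intro specializes_sum specializes_prod xX)
  moreover have "seg_sum (2*n+2) X j = x j * Q (j + 1) / B" for j
    unfolding B_def Q_def X_def
    by (rule seg_sum_reflect) (use perx xnz Qnz seg_prod_neq_1[OF zx] in \<open>auto simp: Q_def\<close>)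
  ultimately have QX: "specializes g (Q j) (x j * Q (j + 1) / B)" for j
    by metis
  have Xnz: "X j \<noteq> 0" for j
    by (simp add: X_def xnz Qnz)
  have QXnz: "x j * Q (j + 1) / B \<noteq> 0" for j
    by (simp add: xnz Qnz Bnz)
  show ?thesis
  proof (cases "b mod 2 = i mod 2")
    case True
    then have \<psi>: "\<psi> j b = x j"
      unfolding x_def by (intro periodicD[OF per]) auto
    have "specializes g (s_image n \<psi> i j b)
        (1 / X (j + 1) * ((x j * Q (j + 1) / B) / (x (j + 2) * Q (j + 2 + 1) / B)))"
      using True unfolding s_image_def Let_def x_def[symmetric, abs_def] Q_def[symmetric]
      by (simp only: refl if_True) (intro specializes_intros xX QX Xnz QXnz)
    also have "1 / X (j + 1) * ((x j * Q (j + 1) / B) / (x (j + 2) * Q (j + 2 + 1) / B)) = x j"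
      using xnz Qnz Bnz by (simp add: X_def add.assoc)
    finally show ?thesis by (simp add: \<psi>)
  next
    case False
    then have "b mod 2 = (i + 1) mod 2" by presburger
    then have \<psi>: "\<psi> j b = y j"
      unfolding y_def by (intro periodicD[OF per]) auto
    have "specializes g (s_image n \<psi> i j b)
        (X j * (x j * y j * x (j + 1) * (Q (j + 2) / Q j)) * X (j + 1) *
          ((x (j + 2) * Q (j + 2 + 1) / B) / (x j * Q (j + 1) / B)))"
      using False unfolding s_image_def Let_def x_def[symmetric, abs_def] Q_def[symmetric] y_def[symmetric]
      by (simp only: if_False) (intro specializes_intros xX yY QX QXnz)
    also have "X j * (x j * y j * x (j + 1) * (Q (j + 2) / Q j)) * X (j + 1) *
          ((x (j + 2) * Q (j + 2 + 1) / B) / (x j * Q (j + 1) / B)) = y j"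
      using xnz Qnz Bnz by (simp add: X_def add.assoc)
    finally show ?thesis by (simp add: \<psi>)
  qed
qed

lemma phi_add_2 [simp]: "phi n j (i + 1 + 1) = phi n j i" "phi n j (i + 2) = phi n j i"
  "phi n j (2 + i) = phi n j i"
  by (rule periodicD[OF periodic_phi]; simp)+

lemma phi_2 [simp]: "phi n j 2 = phi n j 0"
  by (rule periodicD[OF periodic_phi]) simp_all

lemma phi_cong: "cong2 n a b \<Longrightarrow> phi n a i = phi n b i"
  by (rule periodicD[OF periodic_phi]) simp_all

lemma alpha_cong: "cong2 n a b \<Longrightarrow> alpha n a = alpha n b"
  by (simp add: alpha_def phi_cong[of n a b])

lemma phi_phi': "phi n j i = phi' n (- j) (i - j)"
  by (simp add: phi'_def)

text \<open>For n \<ge> 1 the modulus is at least 4. Distance 3 has to be covered because r_c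
  r_(c+1) r_c involves the indices from c - 1 to c + 2.\<close>

lemma not_cong2_small:
  assumes "n \<ge> 1" "d \<noteq> 0" "\<bar>d\<bar> \<le> 3" "a - b = d"
  shows "\<not> cong2 n a b"
  by (rule not_cong2) (use assms in \<open>auto simp: N_def\<close>)

definition r_image :: "nat \<Rightarrow> int \<Rightarrow> int \<Rightarrow> int \<Rightarrow> K" where
  "r_image n j a i = (if cong2 n a (j - 1) then
       phi n (j - 1) i * phi n j (i + 1) * (1 + phi n j i) / (1 + phi n j (i + 1))
     else if cong2 n a j then 1 / phi n j (i + 1)
     else if cong2 n a (j + 1) then
       phi n j i * phi n (j + 1) i * (1 + phi n j (i + 1)) / (1 + phi n j i)
     else phi n a i)"

lemma r_r_image: "r n j = aut n (r_image n j)"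
  by (simp add: r_def r_image_def[abs_def])

lemma periodic_r_image: "periodic n (r_image n j)"
  unfolding periodic_def
proof (intro allI impI)
  fix a i a' i' assume c: "cong2 n a a'" and i: "i mod 2 = i' mod (2::int)"
  have "cong2 n a b \<longleftrightarrow> cong2 n a' b" for b
    using c by (simp add: cong2_def)
  moreover have "phi n b i = phi n b i'" for b
    by (rule periodicD[OF periodic_phi]) (simp_all add: i)
  moreover have "phi n b (i + 1) = phi n b (i' + 1)" for b
    by (rule periodicD[OF periodic_phi]) (use i in \<open>simp, presburger\<close>)
  moreover have "phi n a i' = phi n a' i'"
    by (rule phi_cong[OF c])
  ultimately show "r_image n j a i = r_image n j a' i'"
    by (simp only: r_image_def)
qed

text \<open>This is r_j applied twice to e = phi_(j-1,i), where u and v are phi_(j,i) and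
  phi_(j,i+1): r_j sends u to 1/v and v to 1/u.\<close>

lemma reflect_pred:
  fixes e u v :: "'a::field"
  assumes "u \<noteq> 0" "v \<noteq> 0" "1 + u \<noteq> 0" "1 + v \<noteq> 0"
  shows "e * v * (1 + u) / (1 + v) * (1 / u) * (1 + 1 / v) / (1 + 1 / u) = e"
proof -
  have "1 + 1 / v = (1 + v) / v" "1 + 1 / u = (1 + u) / u"
    using assms by (simp_all add: field_simps)
  then show ?thesis using assms by simp
qed

lemma reflect_succ:
  fixes e u v :: "'a::field"
  assumes "u \<noteq> 0" "v \<noteq> 0" "1 + u \<noteq> 0" "1 + v \<noteq> 0"
  shows "1 / v * (u * e * (1 + v) / (1 + u)) * (1 + 1 / u) / (1 + 1 / v) = e"
proof -
  have "1 + 1 / v = (1 + v) / v" "1 + 1 / u = (1 + u) / u"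
    using assms by (simp_all add: field_simps)
  then show ?thesis using assms by simp
qed

section \<open>The reflections r_j\<close>

context
  fixes n :: nat
  assumes n: "n \<ge> 1"
begin

lemma r_image_pred: "r_image n j (j - 1) i =
    phi n (j - 1) i * phi n j (i + 1) * (1 + phi n j i) / (1 + phi n j (i + 1))"
  by (simp add: r_image_def)

lemma r_image_at: "r_image n j j i = 1 / phi n j (i + 1)"
  using not_cong2_small[OF n, of 1 j "j - 1"] by (simp add: r_image_def)

lemma r_image_succ: "r_image n j (j + 1) i =
    phi n j i * phi n (j + 1) i * (1 + phi n j (i + 1)) / (1 + phi n j i)"
  using not_cong2_small[OF n, of 2 "j + 1" "j - 1"] not_cong2_small[OF n, of 1 "j + 1" j]
  by (simp add: r_image_def)

lemma faithful_r_image: "faithful (assignment n (r_image n j))"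
proof (rule faithful_assignment)
  fix a i
  let ?g = "assignment n (r_image n j)"
  note sp = specializes_assignment[OF periodic_r_image, of n j]
  have at: "specializes ?g (phi n j b) (1 / phi n j (b + 1))" for b
    using sp[of j b] by (simp add: r_image_at)
  have nz: "1 + 1 / phi n j b \<noteq> 0" for b
    by (simp add: add_divide_eq_iff divide_add_eq_iff add_num_frac)
  consider "cong2 n a (j - 1)" | "cong2 n a j" | "cong2 n a (j + 1)"
    | "\<not> cong2 n a (j - 1)" "\<not> cong2 n a j" "\<not> cong2 n a (j + 1)" by blast
  then show "specializes ?g (r_image n j a i) (phi n a i)"
  proof cases
    case 1
    have "specializes ?g (phi n (j - 1) i * phi n j (i + 1) * (1 + phi n j i) / (1 + phi n j (i + 1)))
       (phi n (j - 1) i * phi n j (i + 1) * (1 + phi n j i) / (1 + phi n j (i + 1)) *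
        (1 / phi n j (i + 1 + 1)) * (1 + 1 / phi n j (i + 1)) / (1 + 1 / phi n j (i + 1 + 1)))"
      by (intro specializes_intros at nz sp[of "j - 1" i, unfolded r_image_pred])
    also have "phi n (j - 1) i * phi n j (i + 1) * (1 + phi n j i) / (1 + phi n j (i + 1)) *
        (1 / phi n j (i + 1 + 1)) * (1 + 1 / phi n j (i + 1)) / (1 + 1 / phi n j (i + 1 + 1)) = phi n (j - 1) i"
      unfolding phi_add_2 by (rule reflect_pred) simp_all
    finally show ?thesis
      using periodicD[OF periodic_r_image 1 refl] by (simp add: r_image_pred phi_cong[OF 1])
  next
    case 2
    have "specializes ?g (1 / phi n j (i + 1)) (1 / (1 / phi n j (i + 1 + 1)))"
      by (intro specializes_intros at) simp
    then show ?thesis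
      using periodicD[OF periodic_r_image 2 refl] by (simp add: r_image_at phi_cong[OF 2])
  next
    case 3
    have "specializes ?g (phi n j i * phi n (j + 1) i * (1 + phi n j (i + 1)) / (1 + phi n j i))
       (1 / phi n j (i + 1) * (phi n j i * phi n (j + 1) i * (1 + phi n j (i + 1)) / (1 + phi n j i)) *
        (1 + 1 / phi n j (i + 1 + 1)) / (1 + 1 / phi n j (i + 1)))"
      by (intro specializes_intros at nz sp[of "j + 1" i, unfolded r_image_succ])
    also have "1 / phi n j (i + 1) * (phi n j i * phi n (j + 1) i * (1 + phi n j (i + 1)) / (1 + phi n j i)) *
        (1 + 1 / phi n j (i + 1 + 1)) / (1 + 1 / phi n j (i + 1)) = phi n (j + 1) i"
      unfolding phi_add_2 by (rule reflect_succ) simp_all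
    finally show ?thesis
      using periodicD[OF periodic_r_image 3 refl] by (simp add: r_image_succ phi_cong[OF 3])
  next
    case 4
    then show ?thesis
      using sp[of a i] by (simp add: r_image_def)
  qed
qed

lemma field_hom_r: "field_hom (r n j)"
  unfolding r_r_image by (rule field_hom_aut[OF faithful_r_image])

lemma r_phi: "r n j (phi n a i) = r_image n j a i"
  unfolding r_r_image by (rule aut_phi[OF faithful_r_image periodic_r_image])

lemma r_phi_pred: "r n j (phi n (j - 1) i) =
    phi n (j - 1) i * phi n j (i + 1) * (1 + phi n j i) / (1 + phi n j (i + 1))"
  by (simp only: r_phi r_image_pred)

lemma r_phi_at: "r n j (phi n j i) = 1 / phi n j (i + 1)"
  by (simp only: r_phi r_image_at)

lemma r_phi_succ: "r n j (phi n (j + 1) i) =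
    phi n j i * phi n (j + 1) i * (1 + phi n j (i + 1)) / (1 + phi n j i)"
  by (simp only: r_phi r_image_succ)

lemma r_phi_other:
  "\<not> cong2 n a (j - 1) \<Longrightarrow> \<not> cong2 n a j \<Longrightarrow> \<not> cong2 n a (j + 1) \<Longrightarrow> r n j (phi n a i) = phi n a i"
  by (simp add: r_phi r_image_def)

lemma r_alpha_pred: "r n j (alpha n (j - 1)) = alpha n (j - 1) * alpha n j"
  by (simp add: alpha_def field_hom_simps[OF field_hom_r] r_phi_pred)

lemma r_alpha_at: "r n j (alpha n j) = 1 / alpha n j"
  by (simp add: alpha_def field_hom_simps[OF field_hom_r] r_phi_at)

lemma r_alpha_succ: "r n j (alpha n (j + 1)) = alpha n j * alpha n (j + 1)"
  by (simp add: alpha_def field_hom_simps[OF field_hom_r] r_phi_succ)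

lemma r_alpha_other:
  "\<not> cong2 n a (j - 1) \<Longrightarrow> \<not> cong2 n a j \<Longrightarrow> \<not> cong2 n a (j + 1) \<Longrightarrow> r n j (alpha n a) = alpha n a"
  by (simp add: alpha_def field_hom_simps[OF field_hom_r] r_phi_other)

end

section \<open>Index shifts and rho\<close>

lemma faithful_shift: "faithful (assignment n (\<lambda>j i. phi n (j + a) (i + b)))"
  (is "faithful (assignment n ?F)")
proof (rule faithful_assignment)
  let ?G = "\<lambda>j i. phi n (j - a) (i - b)"
  have "periodic n ?G"
    unfolding periodic_def
  proof (intro allI impI)
    fix j i j' i' assume "cong2 n j j'" "i mod 2 = i' mod (2::int)"
    moreover from this have "(i - b) mod 2 = (i' - b) mod 2"
      by presburger
    ultimately show "?G j i = ?G j' i'"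
      using cong2_add[of n j j' "- a"] by (intro periodicD[OF periodic_phi]) simp_all
  qed
  then show "specializes (assignment n ?G) (?F j i) (phi n j i)" for j i
    using specializes_assignment[of n ?G "j + a" "i + b"] by simp
qed

lemma periodic_shift: "periodic n (\<lambda>j i. phi n (j + a) (i + b))"
  unfolding periodic_def
proof (intro allI impI)
  fix j i j' i' assume "cong2 n j j'" "i mod 2 = i' mod (2::int)"
  moreover from this have "(i + b) mod 2 = (i' + b) mod 2"
    by presburger
  ultimately show "phi n (j + a) (i + b) = phi n (j' + a) (i' + b)"
    by (intro periodicD[OF periodic_phi] cong2_add)
qed

lemma field_hom_pi: "field_hom (pi n)"
  and pi_phi: "pi n (phi n j i) = phi n (j + 1) (i + 1)"
  unfolding pi_def
  by (rule field_hom_aut[OF faithful_shift], rule aut_phi[OF faithful_shift periodic_shift])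

lemma field_hom_pi'_inv: "field_hom (pi'_inv n)"
  and pi'_inv_phi: "pi'_inv n (phi n j i) = phi n (j - 1) i"
proof -
  have eq: "pi'_inv n = aut n (\<lambda>j i. phi n (j + (- 1)) (i + 0))"
    by (simp add: pi'_inv_def)
  show "field_hom (pi'_inv n)"
    unfolding eq by (rule field_hom_aut[OF faithful_shift])
  show "pi'_inv n (phi n j i) = phi n (j - 1) i"
    unfolding eq aut_phi[OF faithful_shift periodic_shift] by simp
qed

lemma faithful_phi': "faithful (assignment n (phi' n))"
proof (rule faithful_assignment)
  show "specializes (assignment n (phi' n)) (phi' n j i) (phi n j i)" for j i
    using specializes_assignment[OF periodic_phi', of n "- j" "i - j"] by (simp add: phi'_def)
qed

lemma rho_phi: "rho n (phi n j i) = phi' n j i"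
  unfolding rho_def by (rule aut_phi[OF faithful_phi' periodic_phi'])

lemma field_hom_rho: "field_hom (rho n)"
  unfolding rho_def by (rule field_hom_aut[OF faithful_phi'])

section \<open>The transformations s_i and s'_i\<close>

lemma faithful_s_image: "faithful (assignment n (s_image n (phi n) i))"
  by (rule faithful_assignment, rule s_image_involution)
    (auto intro: periodic_phi specializes_zero_phi specializes_assignment periodic_s_image)

lemma s_s_image: "s n i = aut n (s_image n (phi n) i)"
proof -
  have "Qf n j i = seg_sum (2*n+2) (\<lambda>m. phi n m i) j" for j
    by (simp add: Qf_def seg_sum_def seg_prod_def)
  then show ?thesis
    by (simp only: s_def s_image_def[abs_def] Let_def)
qed

lemma field_hom_s: "field_hom (s n i)"
  and s_phi: "s n i (phi n j b) = s_image n (phi n) i j b"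
  unfolding s_s_image
  by (rule field_hom_aut[OF faithful_s_image],
      rule aut_phi[OF faithful_s_image periodic_s_image[OF periodic_phi]])

lemma s'_s_image: "s' n i = aut n (\<lambda>a b. s_image n (phi' n) i (- a) (b - a))"
proof -
  have "Qf' n j i = seg_sum (2*n+2) (\<lambda>m. phi' n m i) j" for j
    by (simp add: Qf'_def seg_sum_def seg_prod_def)
  then show ?thesis
    by (simp only: s'_def s_image_def[abs_def] Let_def)
qed

lemma periodic_s'_image: "periodic n (\<lambda>a b. s_image n (phi' n) i (- a) (b - a))"
  unfolding periodic_def
proof (intro allI impI)
  fix a b a' b' assume "cong2 n a a'" "b mod 2 = b' mod (2::int)"
  moreover from this have "(b - a) mod 2 = (b' - a') mod 2"
    using cong2_parity[of n a a'] by presburger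
  ultimately show "s_image n (phi' n) i (- a) (b - a) = s_image n (phi' n) i (- a') (b' - a')"
    by (intro periodicD[OF periodic_s_image[OF periodic_phi']] cong2_minus)
qed

text \<open>The twist (j, i) -> (-j, i - j) is an involution, so on the phi' the assignment takes
  its untwisted form.\<close>

lemma specializes_s'_image:
  "specializes (assignment n (\<lambda>a b. s_image n (phi' n) i (- a) (b - a))) (phi' n j b) (s_image n (phi' n) i j b)"
  using specializes_assignment[OF periodic_s'_image, of n i "- j" "b - j"] by (simp add: phi'_def[of n j b])

lemma faithful_s'_image: "faithful (assignment n (\<lambda>a b. s_image n (phi' n) i (- a) (b - a)))"
proof (rule faithful_assignment)
  fix a b
  have "specializes (assignment n (\<lambda>a b. s_image n (phi' n) i (- a) (b - a)))
      (s_image n (phi' n) i (- a) (b - a)) (phi' n (- a) (b - a))"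
    by (rule s_image_involution)
      (auto intro: periodic_phi' specializes_zero_phi' specializes_s'_image)
  then show "specializes (assignment n (\<lambda>a b. s_image n (phi' n) i (- a) (b - a)))
      (s_image n (phi' n) i (- a) (b - a)) (phi n a b)"
    by (simp add: phi_phi')
qed

lemma field_hom_s': "field_hom (s' n i)"
  unfolding s'_s_image by (rule field_hom_aut[OF faithful_s'_image])

lemma s'_phi': "s' n i (phi' n j b) = s_image n (phi' n) i j b"
  unfolding s'_s_image aut_assignment by (rule subst_eqI[OF faithful_s'_image specializes_s'_image])

section \<open>Consistency with condition (C)\<close>

lemma specializes_zero_nonzero: "specializes (\<lambda>_. 0) f v \<Longrightarrow> v = 1 \<Longrightarrow> f \<noteq> 0"
  using specializes_nonzero[of "\<lambda>_. 0" f v] by simp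

text \<open>Nothing is asked of phi_(m,0): as alpha_m / phi_(m,1) it must specialize to -v.\<close>

definition consistent :: "nat \<Rightarrow> (K \<Rightarrow> K) \<Rightarrow> bool" where
  "consistent n \<omega> \<longleftrightarrow> field_hom \<omega> \<and>
    (\<forall>m. odd m \<longrightarrow> specializes (eps_img n) (\<omega> (phi n m 1)) (- 1) \<and>
      (\<exists>v. specializes (eps_img n) (\<omega> (alpha n m)) v))"

lemma consistent_eps:
  assumes "consistent n \<omega>" "odd m"
  shows "eps n (\<omega> (phi n m 1)) = Some (- 1) \<and>
    (\<exists>v. eps n (\<omega> (alpha n m)) = Some v \<and> eps n (\<omega> (phi n m 0)) = Some (- v))"
proof -
  have hom: "field_hom \<omega>" and 1: "specializes (eps_img n) (\<omega> (phi n m 1)) (- 1)"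
    using assms by (auto simp: consistent_def)
  obtain v where 2: "specializes (eps_img n) (\<omega> (alpha n m)) v"
    using assms by (auto simp: consistent_def)
  have "phi n m 0 = alpha n m / phi n m 1"
    by (simp add: alpha_def)
  then have "\<omega> (phi n m 0) = \<omega> (alpha n m) / \<omega> (phi n m 1)"
    by (simp only: field_hom_divide[OF hom])
  moreover have "specializes (eps_img n) (\<omega> (alpha n m) / \<omega> (phi n m 1)) (v / - 1)"
    by (intro specializes_divide 1 2) simp
  ultimately show ?thesis
    using 1 2 by (auto intro: eps_eqI)
qed

inductive_set alpha_monomials :: "nat \<Rightarrow> K set" for n where
  "1 \<in> alpha_monomials n"
| "alpha n j \<in> alpha_monomials n"
| "a \<in> alpha_monomials n \<Longrightarrow> b \<in> alpha_monomials n \<Longrightarrow> a * b \<in> alpha_monomials n"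
| "a \<in> alpha_monomials n \<Longrightarrow> b \<in> alpha_monomials n \<Longrightarrow> a / b \<in> alpha_monomials n"

text \<open>Nonvanishing is carried along because the quotient case needs a surviving denominator;
  under (C) a factor phi_(j,1) with j odd becomes -1 and not 0.\<close>

lemma specializes_eps_alpha_monomial:
  assumes "f \<in> alpha_monomials n"
  shows "\<exists>v. v \<noteq> 0 \<and> specializes (eps_img n) f v"
  using assms
proof induction
  case (2 j)
  have "specializes (eps_img n) (alpha n j) (phi n j 0 * (if odd j then - 1 else phi n j 1))"
    unfolding alpha_def using specializes_eps_phi[of n j 0] specializes_eps_phi[of n j 1]
    by (intro specializes_mult) simp_all
  moreover have "phi n j 0 * (if odd j then - 1 else phi n j 1) \<noteq> 0"
    by simp
  ultimately show ?case by blast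
next
  case (3 a b)
  then obtain v w where "v \<noteq> 0" "specializes (eps_img n) a v" "w \<noteq> 0" "specializes (eps_img n) b w"
    by blast
  then show ?case
    by (intro exI[of _ "v * w"]) (simp add: specializes_mult)
next
  case (4 a b)
  then obtain v w where "v \<noteq> 0" "specializes (eps_img n) a v" "w \<noteq> 0" "specializes (eps_img n) b w"
    by blast
  then show ?case
    by (intro exI[of _ "v / w"]) (simp add: specializes_divide)
next
  case 1
  show ?case
    by (intro exI[of _ 1]) simp
qed

definition monomial_hom :: "nat \<Rightarrow> (K \<Rightarrow> K) \<Rightarrow> bool" where
  "monomial_hom n f \<longleftrightarrow> field_hom f \<and> f ` alpha_monomials n \<subseteq> alpha_monomials n"

lemma monomial_homI:
  assumes f: "field_hom f" and "\<And>j. f (alpha n j) \<in> alpha_monomials n"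
  shows "monomial_hom n f"
proof -
  have "f a \<in> alpha_monomials n" if "a \<in> alpha_monomials n" for a
    using that
    by induction (auto simp: field_hom_simps[OF f] intro: alpha_monomials.intros assms(2))
  then show ?thesis
    using f by (auto simp: monomial_hom_def)
qed

lemma monomial_hom_comp: "monomial_hom n f \<Longrightarrow> monomial_hom n h \<Longrightarrow> monomial_hom n (f \<circ> h)"
  by (auto simp: monomial_hom_def field_hom_comp)

lemma consistentI:
  assumes "monomial_hom n \<omega>"
    and "\<And>m. odd m \<Longrightarrow> specializes (eps_img n) (\<omega> (phi n m 1)) (- 1)"
  shows "consistent n \<omega>"
  unfolding consistent_def
proof (intro conjI allI impI assms(2))
  show "field_hom \<omega>"
    using assms(1) by (simp add: monomial_hom_def)
  fix m
  have "\<omega> (alpha n m) \<in> alpha_monomials n"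
    using assms(1) alpha_monomials.intros(2) by (auto simp: monomial_hom_def)
  then show "\<exists>v. specializes (eps_img n) (\<omega> (alpha n m)) v"
    using specializes_eps_alpha_monomial by blast
qed

lemma eps_odd: "odd j \<Longrightarrow> odd i \<Longrightarrow> specializes (eps_img n) (phi n j i) (- 1)"
  and eps_fix: "even j \<or> even i \<Longrightarrow> specializes (eps_img n) (phi n j i) (phi n j i)"
  using specializes_eps_phi[of n j i] by auto

section \<open>The transformations p_i and p'_i\<close>

context
  fixes n :: nat
  assumes n: "n \<ge> 1"
begin

text \<open>p_i is the case c = -2i - 3 and p'_i the case c = -2i - 4, so both parities of c occur.
  The odd indices affected are c and c + 2, or c - 1 and c + 1.\<close>

definition braid :: "int \<Rightarrow> K \<Rightarrow> K" where
  "braid c = r n c \<circ> r n (c + 1) \<circ> r n c"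

lemmas hom_r = field_hom_simps[OF field_hom_r[OF n]]

lemma r_step:
  "r n (c + 1) (phi n c i) =
    phi n c i * phi n (c + 1) (i + 1) * (1 + phi n (c + 1) i) / (1 + phi n (c + 1) (i + 1))"
  "r n (c + 1) (phi n (c + 2) i) =
    phi n (c + 1) i * phi n (c + 2) i * (1 + phi n (c + 1) (i + 1)) / (1 + phi n (c + 1) i)"
  "r n (c + 1) (phi n (c - 1) i) = phi n (c - 1) i"
  "r n c (phi n (c + 2) i) = phi n (c + 2) i"
  using r_phi_pred[OF n, of "c + 1" i] r_phi_succ[OF n, of "c + 1" i]
  by (simp_all add: add.assoc) (rule r_phi_other[OF n]; rule not_cong2_small[OF n, OF _ _ refl]; simp)+

lemmas braid_simps = braid_def hom_r r_step r_phi_at[OF n] r_phi_succ[OF n] r_phi_pred[OF n]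

text \<open>The two inner sums are put over 1 + phi_(c,0) and 1 + phi_(c,1). These denominators
  cancel, and what is left below survives phi_(c,1) = -1.\<close>

lemma braid_phi_at:
  "braid c (phi n c 1) =
    (1 + phi n c 1 + phi n c 1 * phi n (c + 1) 1 * (1 + phi n c 0)) /
    (phi n (c + 1) 1 * (1 + phi n c 0 + phi n c 0 * phi n (c + 1) 0 * (1 + phi n c 1)))"
proof -
  have alg: "1 / (1 / x1 * (x1 * y1 * (1 + x0) / (1 + x1)) * (1 + x0 * y0 * (1 + x1) / (1 + x0)) /
        (1 + x1 * y1 * (1 + x0) / (1 + x1))) =
      (1 + x1 + x1 * y1 * (1 + x0)) / (y1 * (1 + x0 + x0 * y0 * (1 + x1)))"
    if "x1 \<noteq> 0" "1 + x0 \<noteq> 0" "1 + x1 \<noteq> 0" for x0 x1 y0 y1 :: K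
  proof -
    have "1 + x0 * y0 * (1 + x1) / (1 + x0) = (1 + x0 + x0 * y0 * (1 + x1)) / (1 + x0)"
      "1 + x1 * y1 * (1 + x0) / (1 + x1) = (1 + x1 + x1 * y1 * (1 + x0)) / (1 + x1)"
      using that by (simp_all add: add_divide_distrib)
    then show ?thesis using that by simp
  qed
  have "braid c (phi n c 1) = 1 / (1 / phi n c 1 * (phi n c 1 * phi n (c + 1) 1 * (1 + phi n c 0) / (1 + phi n c 1)) *
      (1 + phi n c 0 * phi n (c + 1) 0 * (1 + phi n c 1) / (1 + phi n c 0)) /
        (1 + phi n c 1 * phi n (c + 1) 1 * (1 + phi n c 0) / (1 + phi n c 1)))"
    by (simp only: braid_simps o_def phi_2 add_0 one_add_one)
  then show ?thesis
    by (simp only: alg phi_nonzero one_plus_phi_nonzero not_False_eq_True)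
qed

lemma braid_phi_succ_succ:
  "braid c (phi n (c + 2) 1) =
    phi n c 1 * phi n (c + 1) 1 * phi n (c + 2) 1 *
    (1 + phi n c 0 + phi n c 0 * phi n (c + 1) 0 * (1 + phi n c 1)) /
    (1 + phi n c 1 + phi n c 1 * phi n (c + 1) 1 * (1 + phi n c 0))"
proof -
  have alg: "x1 * y1 * (1 + x0) / (1 + x1) * w * (1 + x0 * y0 * (1 + x1) / (1 + x0)) /
        (1 + x1 * y1 * (1 + x0) / (1 + x1)) =
      x1 * y1 * w * (1 + x0 + x0 * y0 * (1 + x1)) / (1 + x1 + x1 * y1 * (1 + x0))"
    if "x1 \<noteq> 0" "1 + x0 \<noteq> 0" "1 + x1 \<noteq> 0" for x0 x1 y0 y1 w :: K
  proof -
    have "1 + x0 * y0 * (1 + x1) / (1 + x0) = (1 + x0 + x0 * y0 * (1 + x1)) / (1 + x0)"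
      "1 + x1 * y1 * (1 + x0) / (1 + x1) = (1 + x1 + x1 * y1 * (1 + x0)) / (1 + x1)"
      using that by (simp_all add: add_divide_distrib)
    then show ?thesis using that by simp
  qed
  have "braid c (phi n (c + 2) 1) = phi n c 1 * phi n (c + 1) 1 * (1 + phi n c 0) / (1 + phi n c 1) *
      phi n (c + 2) 1 * (1 + phi n c 0 * phi n (c + 1) 0 * (1 + phi n c 1) / (1 + phi n c 0)) /
        (1 + phi n c 1 * phi n (c + 1) 1 * (1 + phi n c 0) / (1 + phi n c 1))"
    by (simp only: braid_simps o_def phi_2 add_0 one_add_one)
  then show ?thesis
    by (simp only: alg phi_nonzero one_plus_phi_nonzero not_False_eq_True)
qed

text \<open>This expression is the denominator left by the inner two reflections of the braid.\<close>
lemma r_braid_denominator: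
  "r n c (1 + phi n (c + 1) i + phi n c (i + 1) * phi n (c + 1) i * (1 + phi n (c + 1) (i + 1))) =
    1 + phi n (c + 1) i + phi n c (i + 1) * phi n (c + 1) i * (1 + phi n (c + 1) (i + 1))"
proof -
  have alg: "1 + x1 * y1 * (1 + x0) / (1 + x1) + 1 / x1 * (x1 * y1 * (1 + x0) / (1 + x1)) *
      (1 + x0 * y0 * (1 + x1) / (1 + x0)) = 1 + y1 + x0 * y1 * (1 + y0)"
    if "x1 \<noteq> 0" "1 + x0 \<noteq> 0" "1 + x1 \<noteq> 0" for x0 x1 y0 y1 :: K
  proof -
    \<comment> \<open>The two terms containing p = y1 (1 + x0) have the weights x1 / (1 + x1) and 1
      / (1 + x1), which add up to 1.\<close>
    have tel: "x1 * p / (1 + x1) + p / (1 + x1) = p" for p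
      unfolding add_divide_distrib[symmetric] using that(3)
      by (simp add: divide_eq_eq algebra_simps)
    have "1 / x1 * (x1 * y1 * a / b) * (1 + x0 * y0 * b / a) = y1 * a / b + x0 * y0 * y1"
      if "a \<noteq> 0" "b \<noteq> 0" for a b
      using that \<open>x1 \<noteq> 0\<close> by (simp add: field_simps)
    from this[OF that(2,3)]
    have "1 + x1 * y1 * (1 + x0) / (1 + x1) + 1 / x1 * (x1 * y1 * (1 + x0) / (1 + x1)) *
        (1 + x0 * y0 * (1 + x1) / (1 + x0)) =
        1 + (x1 * (y1 * (1 + x0)) / (1 + x1) + y1 * (1 + x0) / (1 + x1)) + x0 * y0 * y1"
      by (simp add: mult.assoc add.assoc)
    then show ?thesis
      unfolding tel by (simp add: algebra_simps)
  qed
  show ?thesis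
    by (simp only: hom_r phi_add_2 r_phi_at[OF n] r_phi_succ[OF n] alg phi_nonzero
        one_plus_phi_nonzero not_False_eq_True)
qed

text \<open>By \<open>r_braid_denominator\<close> the outer r_c fixes both sums left by the inner
  two reflections, so that only the prefactor phi_(c,1) changes, to 1 / phi_(c,0).\<close>

lemma braid_phi_succ:
  "braid c (phi n (c + 1) 1) =
    (1 + phi n (c + 1) 1 + phi n c 0 * phi n (c + 1) 1 * (1 + phi n (c + 1) 0)) /
    (phi n c 0 * (1 + phi n (c + 1) 0 + phi n c 1 * phi n (c + 1) 0 * (1 + phi n (c + 1) 1)))"
proof -
  have alg: "x1 * y0 * (1 + y1) / (1 + y0) * (1 / y0) * (1 + x0 * y1 * (1 + y0) / (1 + y1)) /
        (1 + x1 * y0 * (1 + y1) / (1 + y0)) =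
      x1 * (1 + y1 + x0 * y1 * (1 + y0)) / (1 + y0 + x1 * y0 * (1 + y1))"
    if "y0 \<noteq> 0" "1 + y0 \<noteq> 0" "1 + y1 \<noteq> 0" for x0 x1 y0 y1 :: K
  proof -
    have "1 + x0 * y1 * (1 + y0) / (1 + y1) = (1 + y1 + x0 * y1 * (1 + y0)) / (1 + y1)"
      "1 + x1 * y0 * (1 + y1) / (1 + y0) = (1 + y0 + x1 * y0 * (1 + y1)) / (1 + y0)"
      using that by (simp_all add: add_divide_distrib)
    then show ?thesis using that by simp
  qed
  have "r n (c + 1) (r n c (phi n (c + 1) 1)) =
      phi n c 1 * (1 + phi n (c + 1) 1 + phi n c 0 * phi n (c + 1) 1 * (1 + phi n (c + 1) 0)) /
      (1 + phi n (c + 1) 0 + phi n c 1 * phi n (c + 1) 0 * (1 + phi n (c + 1) 1))"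
    by (simp only: hom_r r_step r_phi_at[OF n] r_phi_succ[OF n] phi_2 add_0 one_add_one alg
        phi_nonzero one_plus_phi_nonzero not_False_eq_True)
  moreover note r_braid_denominator[of c 0] r_braid_denominator[of c 1]
  ultimately have "braid c (phi n (c + 1) 1) =
      1 / phi n c 0 * (1 + phi n (c + 1) 1 + phi n c 0 * phi n (c + 1) 1 * (1 + phi n (c + 1) 0)) /
      (1 + phi n (c + 1) 0 + phi n c 1 * phi n (c + 1) 0 * (1 + phi n (c + 1) 1))"
    by (simp only: braid_def o_def field_hom_mult[OF field_hom_r[OF n]]
        field_hom_divide[OF field_hom_r[OF n]] phi_2 add_0 one_add_one r_phi_at[OF n])
  then show ?thesis by simp
qed

text \<open>Here the outer r_c changes nothing at all: it fixes both sums, and also the prefactor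
  phi_(c-1,1) phi_(c,0) phi_(c+1,1), in which the new factors cancel.\<close>

lemma braid_phi_pred:
  "braid c (phi n (c - 1) 1) =
    phi n (c - 1) 1 * phi n c 0 * phi n (c + 1) 1 *
    (1 + phi n (c + 1) 0 + phi n c 1 * phi n (c + 1) 0 * (1 + phi n (c + 1) 1)) /
    (1 + phi n (c + 1) 1 + phi n c 0 * phi n (c + 1) 1 * (1 + phi n (c + 1) 0))"
proof -
  have alg: "e * (x0 * y1 * (1 + y0) / (1 + y1)) * (1 + x1 * y0 * (1 + y1) / (1 + y0)) /
        (1 + x0 * y1 * (1 + y0) / (1 + y1)) =
      e * x0 * y1 * (1 + y0 + x1 * y0 * (1 + y1)) / (1 + y1 + x0 * y1 * (1 + y0))"
    if "1 + y0 \<noteq> 0" "1 + y1 \<noteq> 0" for x0 x1 y0 y1 e :: K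
  proof -
    have "1 + x0 * y1 * (1 + y0) / (1 + y1) = (1 + y1 + x0 * y1 * (1 + y0)) / (1 + y1)"
      "1 + x1 * y0 * (1 + y1) / (1 + y0) = (1 + y0 + x1 * y0 * (1 + y1)) / (1 + y0)"
      using that by (simp_all add: add_divide_distrib)
    then show ?thesis using that by simp
  qed
  have "r n (c + 1) (r n c (phi n (c - 1) 1)) =
      phi n (c - 1) 1 * phi n c 0 * phi n (c + 1) 1 *
      (1 + phi n (c + 1) 0 + phi n c 1 * phi n (c + 1) 0 * (1 + phi n (c + 1) 1)) /
      (1 + phi n (c + 1) 1 + phi n c 0 * phi n (c + 1) 1 * (1 + phi n (c + 1) 0))"
    by (simp only: hom_r r_step r_phi_at[OF n] r_phi_pred[OF n] phi_2 add_0 one_add_one alg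
        phi_nonzero one_plus_phi_nonzero not_False_eq_True)
  moreover note r_braid_denominator[of c 0] r_braid_denominator[of c 1]
  ultimately have "braid c (phi n (c - 1) 1) =
      phi n (c - 1) 1 * phi n c 0 * (1 + phi n c 1) / (1 + phi n c 0) * (1 / phi n c 1) *
      (phi n c 1 * phi n (c + 1) 1 * (1 + phi n c 0) / (1 + phi n c 1)) *
      (1 + phi n (c + 1) 0 + phi n c 1 * phi n (c + 1) 0 * (1 + phi n (c + 1) 1)) /
      (1 + phi n (c + 1) 1 + phi n c 0 * phi n (c + 1) 1 * (1 + phi n (c + 1) 0))"
    by (simp only: braid_def o_def field_hom_mult[OF field_hom_r[OF n]]
        field_hom_divide[OF field_hom_r[OF n]] phi_2 add_0 one_add_one r_phi_at[OF n]
        r_phi_pred[OF n] r_phi_succ[OF n])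
  then show ?thesis by simp
qed

lemma braid_phi_other:
  assumes "\<not> cong2 n a (c - 1)" "\<not> cong2 n a c" "\<not> cong2 n a (c + 1)" "\<not> cong2 n a (c + 2)"
  shows "braid c (phi n a i) = phi n a i"
  using assms by (simp add: braid_def r_phi_other[OF n] add.assoc)

lemma monomial_hom_r: "monomial_hom n (r n j)"
proof (rule monomial_homI[OF field_hom_r[OF n]])
  fix a
  consider "cong2 n a (j - 1)" | "cong2 n a j" | "cong2 n a (j + 1)"
    | "\<not> cong2 n a (j - 1)" "\<not> cong2 n a j" "\<not> cong2 n a (j + 1)" by blast
  then show "r n j (alpha n a) \<in> alpha_monomials n"
    by cases (auto simp: alpha_cong r_alpha_pred[OF n] r_alpha_at[OF n] r_alpha_succ[OF n]
        r_alpha_other[OF n] intro!: alpha_monomials.intros)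
qed

text \<open>In each of the four affected classes epsilon removes the first two terms of one sum, as
  1 - 1, and the third term of the other. The same binomial remains above and below, and the
  monomial factors leave -1.\<close>

lemma consistent_braid: "consistent n (braid c)"
proof (rule consistentI)
  show "monomial_hom n (braid c)"
    unfolding braid_def by (intro monomial_hom_comp monomial_hom_r)
next
  fix m :: int assume m: "odd m"
  have even: "specializes (eps_img n) (phi n a 0) (phi n a 0)" for a
    by (rule eps_fix) simp
  consider "cong2 n m (c - 1)" | "cong2 n m c" | "cong2 n m (c + 1)" | "cong2 n m (c + 2)"
    | "\<not> cong2 n m (c - 1)" "\<not> cong2 n m c" "\<not> cong2 n m (c + 1)" "\<not> cong2 n m (c + 2)"
    by blast
  then show "specializes (eps_img n) (braid c (phi n m 1)) (- 1)"
  proof cases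
    case 1
    then have o: "odd (c - 1)" using m cong2_parity by blast
    have odd: "specializes (eps_img n) (phi n (c - 1) 1) (- 1)"
      "specializes (eps_img n) (phi n (c + 1) 1) (- 1)"
      "specializes (eps_img n) (phi n c 1) (phi n c 1)"
      using o by (auto intro: eps_odd eps_fix)
    have "specializes (eps_img n) (braid c (phi n (c - 1) 1))
      (- 1 * phi n c 0 * - 1 *
        (1 + phi n (c + 1) 0 + phi n c 1 * phi n (c + 1) 0 * (1 + - 1)) /
        (1 + - 1 + phi n c 0 * - 1 * (1 + phi n (c + 1) 0)))"
      unfolding braid_phi_pred by (intro specializes_intros even odd) simp
    then show ?thesis
      by (simp add: phi_cong[OF 1])
  next
    case 2
    then have o: "odd c" using m cong2_parity by blast
    have odd: "specializes (eps_img n) (phi n c 1) (- 1)"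
      "specializes (eps_img n) (phi n (c + 1) 1) (phi n (c + 1) 1)"
      using o by (auto intro: eps_odd eps_fix)
    have "specializes (eps_img n) (braid c (phi n c 1))
      ((1 + - 1 + - 1 * phi n (c + 1) 1 * (1 + phi n c 0)) /
       (phi n (c + 1) 1 * (1 + phi n c 0 + phi n c 0 * phi n (c + 1) 0 * (1 + - 1))))"
      unfolding braid_phi_at by (intro specializes_intros even odd) simp
    then show ?thesis
      by (simp add: phi_cong[OF 2])
  next
    case 3
    then have o: "odd (c + 1)" using m cong2_parity by blast
    have odd: "specializes (eps_img n) (phi n (c + 1) 1) (- 1)"
      "specializes (eps_img n) (phi n c 1) (phi n c 1)"
      using o by (auto intro: eps_odd eps_fix)
    have "specializes (eps_img n) (braid c (phi n (c + 1) 1))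
      ((1 + - 1 + phi n c 0 * - 1 * (1 + phi n (c + 1) 0)) /
       (phi n c 0 * (1 + phi n (c + 1) 0 + phi n c 1 * phi n (c + 1) 0 * (1 + - 1))))"
      unfolding braid_phi_succ by (intro specializes_intros even odd) simp
    then show ?thesis
      by (simp add: phi_cong[OF 3])
  next
    case 4
    then have o: "odd (c + 2)" using m cong2_parity by blast
    have odd: "specializes (eps_img n) (phi n (c + 2) 1) (- 1)"
      "specializes (eps_img n) (phi n c 1) (- 1)"
      "specializes (eps_img n) (phi n (c + 1) 1) (phi n (c + 1) 1)"
      using o by (auto intro: eps_odd eps_fix)
    have "specializes (eps_img n) (braid c (phi n (c + 2) 1))
      (- 1 * phi n (c + 1) 1 * - 1 *
        (1 + phi n c 0 + phi n c 0 * phi n (c + 1) 0 * (1 + - 1)) /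
        (1 + - 1 + - 1 * phi n (c + 1) 1 * (1 + phi n c 0)))"
      unfolding braid_phi_succ_succ by (intro specializes_intros even odd) simp
    then show ?thesis
      by (simp add: phi_cong[OF 4])
  next
    case 5
    then show ?thesis
      by (simp add: braid_phi_other eps_odd m)
  qed
qed

end

section \<open>Action on the alphas, and the transformations pi_1 and pi_2\<close>

lemma phi_mod_2: "i mod 2 = i' mod 2 \<Longrightarrow> phi n j i = phi n j i'"
  by (rule periodicD[OF periodic_phi]) simp_all

lemma phi_even_odd: "even i \<Longrightarrow> phi n j i = phi n j 0" "odd i \<Longrightarrow> phi n j i = phi n j 1"
  by (rule phi_mod_2; presburger)+

lemma phi_mult_alpha: "phi n j i * phi n j (i + 1) = alpha n j"
  by (cases "even i") (simp_all add: phi_even_odd[of i] phi_even_odd[of "i + 1"] alpha_def)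

lemma phi'_mult_alpha: "phi' n j i * phi' n j (i + 1) = alpha n (- j)"
  using phi_mult_alpha[of n "- j" "i - j"] by (simp add: phi'_def algebra_simps)

lemma monomial_hom_pi: "monomial_hom n (pi n)"
proof (rule monomial_homI[OF field_hom_pi])
  fix j
  have "pi n (alpha n j) = alpha n (j + 1)"
    using phi_mult_alpha[of n "j + 1" 1]
    by (simp add: alpha_def field_hom_simps[OF field_hom_pi] pi_phi)
  then show "pi n (alpha n j) \<in> alpha_monomials n"
    by (simp add: alpha_monomials.intros)
qed

lemma monomial_hom_pi'_inv: "monomial_hom n (pi'_inv n)"
proof (rule monomial_homI[OF field_hom_pi'_inv])
  fix j
  have "pi'_inv n (alpha n j) = alpha n (j - 1)"
    by (simp add: alpha_def field_hom_simps[OF field_hom_pi'_inv] pi'_inv_phi)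
  then show "pi'_inv n (alpha n j) \<in> alpha_monomials n"
    by (simp add: alpha_monomials.intros)
qed

lemma monomial_hom_rho: "monomial_hom n (rho n)"
proof (rule monomial_homI[OF field_hom_rho])
  fix j
  have "rho n (alpha n j) = alpha n (- j)"
    using phi'_mult_alpha[of n j 0]
    by (simp add: alpha_def field_hom_simps[OF field_hom_rho] rho_phi)
  then show "rho n (alpha n j) \<in> alpha_monomials n"
    by (simp add: alpha_monomials.intros)
qed

text \<open>The ratios of sums in the two rows are inverse to each other, so s_0 and s'_0 fix every
  alpha_j.\<close>

lemma s_image_mult:
  assumes "\<And>j b. specializes (\<lambda>_. 0) (\<psi> j b) 0" "\<And>j b. \<psi> j b \<noteq> 0"
  shows "s_image n \<psi> 0 j 0 * s_image n \<psi> 0 j 1 = \<psi> j 0 * \<psi> j 1"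
proof -
  have "seg_sum (2*n+2) (\<lambda>m. \<psi> m 0) k \<noteq> 0" for k
    by (rule seg_sum_nonzero) (use assms in auto)
  then show ?thesis
    using assms(2) by (simp add: s_image_def Let_def)
qed

lemma monomial_hom_s: "monomial_hom n (s n 0)"
proof (rule monomial_homI[OF field_hom_s])
  fix j
  have "s n 0 (alpha n j) = alpha n j"
    by (simp add: alpha_def field_hom_simps[OF field_hom_s] s_phi s_image_mult specializes_zero_phi)
  then show "s n 0 (alpha n j) \<in> alpha_monomials n"
    by (simp add: alpha_monomials.intros)
qed

lemma monomial_hom_s': "monomial_hom n (s' n 0)"
proof (rule monomial_homI[OF field_hom_s'])
  fix j
  have "s' n 0 (alpha n j) = alpha n j"
    using phi'_mult_alpha[of n "- j" 0, symmetric]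
    by (simp add: field_hom_simps[OF field_hom_s'] s'_phi' s_image_mult specializes_zero_phi')
  then show "s' n 0 (alpha n j) \<in> alpha_monomials n"
    by (simp add: alpha_monomials.intros)
qed

lemma monomial_hom_foldr:
  "(\<And>f. f \<in> set fs \<Longrightarrow> monomial_hom n f) \<Longrightarrow> monomial_hom n (foldr (\<circ>) fs id)"
  by (induction fs) (auto intro!: monomial_hom_comp simp: monomial_hom_def[of n id] field_hom_id)

lemma consistent_pi1: "consistent n (pi1 n)"
proof (rule consistentI)
  show "monomial_hom n (pi1 n)"
    unfolding pi1_def by (intro monomial_hom_comp monomial_hom_pi)
  show "specializes (eps_img n) (pi1 n (phi n m 1)) (- 1)" if "odd m" for m
    unfolding pi1_def o_def pi_phi by (rule eps_odd) (use that in simp_all)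
qed

lemma consistent_pi2: "consistent n (pi2 n)"
proof (rule consistentI)
  show "monomial_hom n (pi2 n)"
    unfolding pi2_def by (intro monomial_hom_comp monomial_hom_pi monomial_hom_pi'_inv monomial_hom_rho)
  show "specializes (eps_img n) (pi2 n (phi n m 1)) (- 1)" if "odd m" for m
    unfolding pi2_def o_def pi_phi pi'_inv_phi rho_phi phi'_def
    by (rule eps_odd) (use that in simp_all)
qed

lemma field_hom_seg_sum: "field_hom f \<Longrightarrow> f (seg_sum m x j) = seg_sum m (\<lambda>k. f (x k)) j"
  by (simp add: seg_sum_def seg_prod_def field_hom_simps)

text \<open>The rightmost factor acts first. Splitting it off lets an induction apply the new
  reflection to a generator before using the hypothesis.\<close>

lemma foldr_comp_Suc:
  "foldr (\<circ>) (map f [0..<Suc m]) id = foldr (\<circ>) (map f [0..<m]) id \<circ> f m"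
proof -
  have *: "foldr (\<circ>) fs g = foldr (\<circ>) fs id \<circ> g" for fs :: "('a \<Rightarrow> 'a) list" and g
    by (induction fs) auto
  show ?thesis
    by (simp add: *[of _ "f m"])
qed

lemma odd_representative:
  assumes "odd m"
  obtains k where "k \<le> n" "cong2 n m (2 * int k + 1)"
proof -
  define t where "t = m mod N n"
  have "odd t"
    using cong2_parity[OF cong2_mod] assms unfolding t_def by blast
  then obtain q where q: "t = 2 * q + 1"
    by (elim oddE)
  have "0 \<le> t" "t < N n"
    by (simp_all add: t_def)
  then have "nat q \<le> n" "int (nat q) = q"
    unfolding N_def q by simp_all
  moreover have "cong2 n m t"
    unfolding t_def by (rule cong2_sym[OF cong2_mod])
  ultimately show thesis
    using that[of "nat q"] by (simp add: q)
qed

section \<open>Products of the reflections with odd and with even index\<close>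

context
  fixes n :: nat
  assumes n: "n \<ge> 1"
begin

lemma monomial_hom_r_odd: "monomial_hom n (r_odd n)"
  unfolding r_odd_def by (rule monomial_hom_foldr) (auto intro: monomial_hom_r[OF n])

lemma monomial_hom_r_even: "monomial_hom n (r_even n)"
  unfolding r_even_def by (rule monomial_hom_foldr) (auto intro: monomial_hom_r[OF n])

lemma r_odd_phi:
  assumes "k \<le> n"
  shows "r_odd n (phi n (2 * int k + 1) i) = 1 / phi n (2 * int k + 1) (i + 1)"
proof -
  let ?f = "\<lambda>k. r n (2 * int k + 1)"
  define R where "R m = foldr (\<circ>) (map ?f [0..<m]) id" for m
  have hom: "field_hom (R m)" for m
    using monomial_hom_foldr[of "map ?f [0..<m]" n] monomial_hom_r[OF n]
    by (auto simp: R_def monomial_hom_def)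
  \<comment> \<open>Partial products make the induction possible. The second index is generalized
    because the step m = k uses the hypothesis at i + 1.\<close>
  have "R m (phi n (2 * int k + 1) i) =
      (if k < m then 1 / phi n (2 * int k + 1) (i + 1) else phi n (2 * int k + 1) i)" if "m \<le> n + 1" for m i
    using that
  proof (induction m arbitrary: i)
    case (Suc m)
    have R: "R (Suc m) x = R m (r n (2 * int m + 1) x)" for x
      unfolding R_def foldr_comp_Suc by simp
    show ?case
    proof (cases "m = k")
      case True
      then show ?thesis
        unfolding R using Suc by (simp add: r_phi_at[OF n] field_hom_simps[OF hom])
    next
      case False
      have "r n (2 * int m + 1) (phi n (2 * int k + 1) i) = phi n (2 * int k + 1) i"
      proof (rule r_phi_other[OF n])
        show "\<not> cong2 n (2 * int k + 1) (2 * int m + 1)"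
          by (rule not_cong2) (use False Suc assms in \<open>auto simp: N_def\<close>)
      qed (use cong2_parity[of n "2 * int k + 1" "2 * int m + 1 - 1"]
          cong2_parity[of n "2 * int k + 1" "2 * int m + 1 + 1"] in auto)
      then show ?thesis
        using Suc False by (simp add: R)
    qed
  qed (simp add: R_def)
  from this[of "n + 1" i] show ?thesis
    using assms by (simp add: R_def r_odd_def)
qed

lemma r_odd_phi_1:
  assumes "odd m"
  shows "r_odd n (phi n m 1) = 1 / phi n m 0"
proof -
  obtain k where k: "k \<le> n" "cong2 n m (2 * int k + 1)"
    using odd_representative[OF assms] .
  show ?thesis
    using r_odd_phi[OF k(1), of 1] by (simp add: phi_cong[OF k(2)])
qed

text \<open>Exactly the reflections at the even neighbours m - 1 and m + 1 move phi_(m,1), and each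
  contributes one factor.\<close>

lemma r_even_phi_1:
  assumes "odd m"
  shows "r_even n (phi n m 1) = phi n m 1 *
    (phi n (m - 1) 1 * (1 + phi n (m - 1) 0) / (1 + phi n (m - 1) 1)) *
    (phi n (m + 1) 0 * (1 + phi n (m + 1) 1) / (1 + phi n (m + 1) 0))"
proof -
  obtain k where k: "k \<le> n" "cong2 n m (2 * int k + 1)"
    using odd_representative[OF assms] .
  \<comment> \<open>2 k' represents the upper neighbour m + 1, which wraps around to 0 when m is the
    last odd index. That k' differs from k uses n \<ge> 1.\<close>
  define k' where "k' = (if k < n then k + 1 else 0)"
  have k': "k' \<le> n" "k' \<noteq> k" "cong2 n (2 * int k + 1 + 1) (2 * int k')"
    using k(1) n by (auto simp: k'_def cong2_iff N_def add.commute)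
  define A B where "A = phi n (2 * int k) 1 * (1 + phi n (2 * int k) 0) / (1 + phi n (2 * int k) 1)"
    and "B = phi n (2 * int k') 0 * (1 + phi n (2 * int k') 1) / (1 + phi n (2 * int k') 0)"
  let ?f = "\<lambda>l. r n (2 * int l)"
  define R where "R l = foldr (\<circ>) (map ?f [0..<l]) id" for l
  have R: "R (Suc l) x = R l (r n (2 * int l) x)" for l x
    unfolding R_def foldr_comp_Suc by simp
  have hom: "field_hom (R l)" for l
    using monomial_hom_foldr[of "map ?f [0..<l]" n] monomial_hom_r[OF n]
    by (auto simp: R_def monomial_hom_def)
  have other: "\<not> cong2 n (2 * a) (2 * b - 1)" "\<not> cong2 n (2 * a) (2 * b + 1)"
    "\<not> cong2 n (2 * a + 1) (2 * b)" for a b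
    using cong2_parity[of n "2 * a" "2 * b - 1"] cong2_parity[of n "2 * a" "2 * b + 1"]
      cong2_parity[of n "2 * a + 1" "2 * b"] by auto
  have neq: "\<not> cong2 n (2 * int a) (2 * int b)" if "a \<le> n" "b \<le> n" "a \<noteq> b" for a b
    by (rule not_cong2) (use that in \<open>auto simp: N_def\<close>)
  \<comment> \<open>The factor contributed at step a involves only the variables of index 2a, and
    these are untouched by the reflections r_(2l) with l < a that act afterwards.\<close>
  have fixed: "R l (phi n (2 * int a) i) = phi n (2 * int a) i" if "l \<le> a" "a \<le> n" for l a i
    using that
  proof (induction l)
    case (Suc l)
    then have "r n (2 * int l) (phi n (2 * int a) i) = phi n (2 * int a) i"
      by (intro r_phi_other[OF n] other neq) auto
    then show ?case using Suc by (simp add: R)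
  qed (simp add: R_def)
  \<comment> \<open>The two conditionals record which neighbours have been reached, in either order,
    as the wrap-around may put k' before k.\<close>
  have "R l (phi n (2 * int k + 1) 1) =
      phi n (2 * int k + 1) 1 * (if k < l then A else 1) * (if k' < l then B else 1)" if "l \<le> n + 1" for l
    using that
  proof (induction l)
    case (Suc l)
    consider "l = k" | "l = k'" | "l \<noteq> k" "l \<noteq> k'" by blast
    then show ?case
    proof cases
      case 1
      have "r n (2 * int l) (phi n (2 * int k + 1) 1) = phi n (2 * int k + 1) 1 * A"
        using r_phi_succ[OF n, of "2 * int k" 1] by (simp add: 1 A_def)
      moreover have "R l A = A"
        using fixed[of l k] k(1) 1 by (simp add: A_def field_hom_simps[OF hom])
      ultimately show ?thesis
        unfolding R using Suc k'(2) 1 by (simp add: field_hom_simps[OF hom])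
    next
      case 2
      have "phi n (2 * int k + 1) 1 = phi n (2 * int k' - 1) 1"
        using k'(3) by (intro phi_cong) (simp add: cong2_iff algebra_simps)
      then have "r n (2 * int l) (phi n (2 * int k + 1) 1) = phi n (2 * int k + 1) 1 * B"
        using r_phi_pred[OF n, of "2 * int k'" 1] by (simp add: 2 B_def)
      moreover have "R l B = B"
        using fixed[of l k'] k'(1) 2 by (simp add: B_def field_hom_simps[OF hom])
      ultimately show ?thesis
        unfolding R using Suc k'(2) 2 by (simp add: field_hom_simps[OF hom])
    next
      case 3
      have "r n (2 * int l) (phi n (2 * int k + 1) 1) = phi n (2 * int k + 1) 1"
      proof (rule r_phi_other[OF n])
        show "\<not> cong2 n (2 * int k + 1) (2 * int l - 1)"
        proof
          assume "cong2 n (2 * int k + 1) (2 * int l - 1)"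
          then have "cong2 n (2 * int l) (2 * int k')"
            using cong2_trans[OF _ k'(3)] cong2_sym[OF cong2_add, of n _ _ 1] by fastforce
          then show False
            using neq[of l k'] k'(1) 3 Suc by auto
        qed
        show "\<not> cong2 n (2 * int k + 1) (2 * int l + 1)"
        proof
          assume "cong2 n (2 * int k + 1) (2 * int l + 1)"
          then have "cong2 n (2 * int k) (2 * int l)"
            using cong2_add[of n "2 * int k + 1" "2 * int l + 1" "- 1"] by simp
          then show False
            using neq[of k l] k(1) 3 Suc by auto
        qed
      qed (rule other)
      then show ?thesis
        using Suc 3 by (simp add: R)
    qed
  qed (simp add: R_def)
  from this[of "n + 1"] have "r_even n (phi n (2 * int k + 1) 1) = phi n (2 * int k + 1) 1 * A * B"
    using k(1) k'(1) by (simp add: R_def r_even_def)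
  moreover have "phi n (2 * int k) i = phi n (m - 1) i" for i
    using cong2_sym[OF k(2)] by (intro phi_cong) (simp add: cong2_iff algebra_simps)
  moreover have "phi n (2 * int k') i = phi n (m + 1) i" for i
    by (intro phi_cong cong2_trans[OF cong2_sym[OF k'(3)]] cong2_sym[OF cong2_add[OF k(2), of 1]])
  ultimately show ?thesis
    by (simp add: A_def B_def phi_cong[OF k(2)])
qed

end

section \<open>The transformation sigma\<close>

lemma seg_sum_reindex: "seg_sum m (\<lambda>k. x (k + c)) j = seg_sum m x (j + c)"
  by (simp add: seg_sum_def seg_prod_def algebra_simps)

text \<open>Write P_k for the product of the first k factors. Since every second factor is -1, the
  pair P_(2k) + P_(2k+1) equals P_(2k) - P_(2k+2).\<close>

lemma seg_sum_alternating:
  fixes z :: "int \<Rightarrow> 'a::field"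
  assumes "\<And>j. odd j \<Longrightarrow> z j = - 1" "even j"
  shows "seg_sum (2 * k) z j = 1 - seg_prod (2 * k) z j"
proof (induction k)
  case (Suc k)
  have "z (j + int (2 * k) + 1) = - 1"
    using assms by simp
  then show ?case
    using Suc by (simp add: seg_sum_def seg_prod_Suc algebra_simps)
qed (simp add: seg_sum_def)

text \<open>The value is the same for all even j, so a quotient of two such sums specializes to
  1.\<close>

lemma specializes_eps_seg_sum:
  defines "z \<equiv> \<lambda>n k. if odd k then - 1 else phi n k 1"
  assumes "even j"
  shows "specializes (eps_img n) (seg_sum (2*n+2) (\<lambda>k. phi n k 1) j) (1 - seg_prod (2*n+2) (z n) 0)"
proof -
  have z: "specializes (eps_img n) (phi n k 1) (z n k)" for k
    using specializes_eps_phi[of n k 1] by (simp add: z_def)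
  have "z n (k + int (2 * n + 2)) = z n k" for k
    using phi_cong[OF cong2_shift_N[of n k], of 1] by (simp add: z_def)
  then have "seg_prod (2*n+2) (z n) j = seg_prod (2*n+2) (z n) 0"
    by (rule seg_prod_shift)
  moreover have "seg_sum (2 * (n + 1)) (z n) j = 1 - seg_prod (2 * (n + 1)) (z n) j"
    by (rule seg_sum_alternating) (use assms(2) in \<open>simp_all add: z_def\<close>)
  moreover have "specializes (eps_img n) (seg_sum (2*n+2) (\<lambda>k. phi n k 1) j) (seg_sum (2*n+2) (z n) j)"
    unfolding seg_sum_def seg_prod_def by (intro specializes_sum specializes_prod z)
  ultimately show ?thesis by simp
qed

text \<open>At the origin the factors of even index vanish, and with them the product.\<close>

lemma seg_prod_alternating_neq_1: "seg_prod (2*n+2) (\<lambda>k. if odd k then - 1 else phi n k 1) 0 \<noteq> 1"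
proof
  let ?z = "\<lambda>k. if odd k then - 1 else phi n k 1"
  assume 1: "seg_prod (2*n+2) ?z 0 = 1"
  have "specializes (\<lambda>_. 0) (seg_prod (2*n+2) ?z 0) (\<Prod>l<2*n+2. if odd (0 + int l) then - 1 else 0)"
    unfolding seg_prod_def
    by (intro specializes_prod) (auto intro: specializes_zero_phi specializes_uminus)
  also have "(\<Prod>l<2*n+2. if odd (0 + int l) then - 1 else 0) = (0 :: K)"
    by (rule prod_zero) (auto intro: bexI[of _ 0])
  finally show False
    using specializes_unique[OF specializes_1] 1 by force
qed

lemma consistent_sigma:
  assumes n: "n \<ge> 1"
  shows "consistent n (sigma n)"
proof (rule consistentI)
  show "monomial_hom n (sigma n)"
    unfolding sigma_def
    by (intro monomial_hom_comp monomial_hom_pi monomial_hom_s monomial_hom_r_odd[OF n])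
next
  fix m :: int assume m: "odd m"
  let ?Q = "\<lambda>j. seg_sum (2*n+2) (\<lambda>k. phi n k 1) j"
  let ?C = "1 - seg_prod (2*n+2) (\<lambda>k. if odd k then - 1 else phi n k 1) 0"
  \<comment> \<open>pi turns Q_(j,0) into Q_(j+1,1), a sum over the variables that (C) sets to
    -1.\<close>
  have Q: "pi n (seg_sum (2*n+2) (\<lambda>k. phi n k 0) j) = ?Q (j + 1)" for j
    unfolding field_hom_seg_sum[OF field_hom_pi] pi_phi add_0 by (rule seg_sum_reindex)
  have "s n 0 (phi n m 0) = 1 / phi n (m + 1) 0 *
      (seg_sum (2*n+2) (\<lambda>k. phi n k 0) m / seg_sum (2*n+2) (\<lambda>k. phi n k 0) (m + 2))"
    by (simp only: s_phi s_image_def Let_def refl if_True)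
  then have "sigma n (phi n m 1) = 1 / (1 / phi n (m + 1 + 1) 1 * (?Q (m + 1) / ?Q (m + 2 + 1)))"
    by (simp only: sigma_def o_def r_odd_phi_1[OF n m] field_hom_simps[OF field_hom_s]
        field_hom_simps[OF field_hom_pi] pi_phi Q add_0)
  also have "\<dots> = phi n (m + 2) 1 * (?Q (m + 3) / ?Q (m + 1))"
    by (simp add: add.assoc)
  finally have sigma: "sigma n (phi n m 1) = phi n (m + 2) 1 * (?Q (m + 3) / ?Q (m + 1))" .
  have "?C \<noteq> 0"
    using seg_prod_alternating_neq_1[of n] by simp
  then have "specializes (eps_img n) (sigma n (phi n m 1)) (- 1 * (?C / ?C))"
    unfolding sigma by (intro specializes_mult specializes_divide specializes_eps_seg_sum eps_odd)
      (use m in auto)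
  then show "specializes (eps_img n) (sigma n (phi n m 1)) (- 1)"
    by (simp only: divide_self[OF \<open>?C \<noteq> 0\<close>] mult_1_right)
qed

section \<open>The transformation sigma'\<close>

text \<open>Clears the compound fractions of sigma'(phi_(m,1)). The letters t, x, y stand for T, x,
  y in the proof below; the suffix is the offset from d, with m for -1.\<close>

lemma sigma'_algebra:
  fixes t0 :: "'a::field"
  assumes "tm \<noteq> 0" "t0 \<noteq> 0" "t1 \<noteq> 0" "t2 \<noteq> 0" "t3 \<noteq> 0" "y0 \<noteq> 0" "y1 \<noteq> 0" "y2 \<noteq> 0"
    and "t1 + y1 * x1 * y2 * t3 \<noteq> 0" "y0 * t1 + tm \<noteq> 0"
  shows "1 / y1 * (t0 / t2) *
      (y1 * x1 * y2 * (t3 / t1) * (1 + 1 / y2 * (t1 / t3)) / (1 + y1 * x1 * y2 * (t3 / t1))) *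
      (1 / y0 * (tm / t1) * (1 + ym * xm * y0 * (t1 / tm)) / (1 + 1 / y0 * (tm / t1))) =
    x1 * t0 * (y2 * t3 + t1) * (tm + ym * xm * y0 * t1) /
      (t2 * (t1 + y1 * x1 * y2 * t3) * (y0 * t1 + tm))"
proof -
  have "1 + 1 / y2 * (t1 / t3) = (y2 * t3 + t1) / (y2 * t3)"
    "1 + y1 * x1 * y2 * (t3 / t1) = (t1 + y1 * x1 * y2 * t3) / t1"
    "1 + ym * xm * y0 * (t1 / tm) = (tm + ym * xm * y0 * t1) / tm"
    "1 + 1 / y0 * (tm / t1) = (y0 * t1 + tm) / (y0 * t1)"
    using assms by (simp_all add: add_divide_distrib)
  then show ?thesis
    using assms by simp
qed

lemma consistent_sigma':
  assumes n: "n \<ge> 1"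
  shows "consistent n (sigma' n)"
proof (rule consistentI)
  show "monomial_hom n (sigma' n)"
    unfolding sigma'_def
    by (intro monomial_hom_comp monomial_hom_pi'_inv monomial_hom_s' monomial_hom_r_even[OF n])
next
  fix m :: int assume m: "odd m"
  \<comment> \<open>By phi_(a,b) = phi'_(-a,b-a), the variable phi_(m,1) becomes x (d - 1), and the
    even neighbours m - 1 and m + 1 sit at d and d - 2.\<close>
  define d where "d = 1 - m"
  have d: "even d" "m = 1 - d"
    using m by (simp_all add: d_def)
  define x y T where "x k = phi' n k 0" and "y k = phi' n k 1" and "T k = seg_sum (2*n+2) y k" for k
  define D where "D = 1 - seg_prod (2*n+2) y 0"
  have per: "phi' n k b = phi' n k' b'" if "k = k'" "b mod 2 = b' mod 2" for k k' b b'
    using that by (intro periodicD[OF periodic_phi']) simp_all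
  have nz: "x k \<noteq> 0" "y k \<noteq> 0" for k
    by (simp_all add: x_def y_def)
  have x0: "specializes (\<lambda>_. 0) (x k) 0" and y0: "specializes (\<lambda>_. 0) (y k) 0" for k
    unfolding x_def y_def by (rule specializes_zero_phi')+
  have T0: "specializes (\<lambda>_. 0) (T k) 1" for k
    unfolding T_def by (rule specializes_zero_seg_sum[OF y0]) simp
  have Tnz: "T k \<noteq> 0" for k
    by (rule specializes_zero_nonzero[OF T0 refl])
  have Dnz: "D \<noteq> 0"
    using seg_prod_neq_1[where x = y and m = "2*n+2" and j = 0, OF y0] by (simp add: D_def)
  have ynz: "1 + y k \<noteq> 0" for k
    by (rule one_plus_nonzero[OF y0])
  have rec: "y k * T (k + 1) = T k - D" for k
    unfolding T_def D_def y_def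
    by (rule seg_sum_rec) (rule periodicD[OF periodic_phi' cong2_shift_N refl])
  \<comment> \<open>Two consecutive instances of the recursion are added so that D cancels.\<close>
  have T_pair: "y (k + 1) * T (k + 1 + 1) + T k = T (k + 1) * (1 + y k)" for k
  proof -
    have "T (k + 1) - D + (y k * T (k + 1) + D) = T (k + 1) * (1 + y k)"
      by (simp add: algebra_simps)
    then show ?thesis by (simp only: rec diff_add_cancel)
  qed
  have pi: "pi'_inv n (phi' n k b) = phi' n (k + 1) (b + 1)" for k b
  proof -
    have "- k - 1 = - (k + 1)" "b - k = b + 1 - (k + 1)" by simp_all
    then show ?thesis by (simp only: phi'_def pi'_inv_phi)
  qed
  have Q: "pi'_inv n (seg_sum (2*n+2) (\<lambda>k. phi' n k 0) k) = T (k + 1)" for k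
    unfolding field_hom_seg_sum[OF field_hom_pi'_inv] pi add_0 T_def y_def[abs_def] by (rule seg_sum_reindex)
  define \<tau> where "\<tau> = pi'_inv n \<circ> s' n 0"
  have hom: "field_hom \<tau>"
    unfolding \<tau>_def by (intro field_hom_comp field_hom_pi'_inv field_hom_s')
  have "s' n 0 (x k) = 1 / phi' n (k + 1) 0 *
      (seg_sum (2*n+2) (\<lambda>k. phi' n k 0) k / seg_sum (2*n+2) (\<lambda>k. phi' n k 0) (k + 2))" for k
    by (simp only: x_def s'_phi' s_image_def Let_def refl if_True)
  then have \<tau>x: "\<tau> (x k) = 1 / y (k + 2) * (T (k + 1) / T (k + 3))" for k
    unfolding \<tau>_def o_def
    by (simp only: field_hom_simps[OF field_hom_pi'_inv] Q pi y_def add_0) (simp add: add.assoc)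
  have "s' n 0 (y k) = phi' n k 0 * phi' n k 1 * phi' n (k + 1) 0 *
      (seg_sum (2*n+2) (\<lambda>k. phi' n k 0) (k + 2) / seg_sum (2*n+2) (\<lambda>k. phi' n k 0) k)" for k
    by (simp add: y_def s'_phi' s_image_def Let_def)
  then have \<tau>y: "\<tau> (y k) = y (k + 1) * x (k + 1) * y (k + 2) * (T (k + 3) / T (k + 1))" for k
    unfolding \<tau>_def o_def
    by (simp only: field_hom_simps[OF field_hom_pi'_inv] Q pi y_def x_def add_0 one_add_one
        per[OF refl, of 2 0]) (simp add: add.assoc per[OF refl, of 2 0])
  have phi_m: "phi n m 1 = x (d - 1)" "phi n (m - 1) 0 = x d" "phi n (m - 1) 1 = y d"
    "phi n (m + 1) 0 = x (d - 2)" "phi n (m + 1) 1 = y (d - 2)"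
    unfolding x_def y_def phi_phi' using d by (auto intro!: per; presburger)+
  have "r_even n (phi n m 1) = x (d - 1) * (y d * (1 + x d) / (1 + y d)) *
      (x (d - 2) * (1 + y (d - 2)) / (1 + x (d - 2)))"
    using r_even_phi_1[OF n m] by (simp only: phi_m)
  then have "sigma' n (phi n m 1) = \<tau> (x (d - 1) * (y d * (1 + x d) / (1 + y d)) *
      (x (d - 2) * (1 + y (d - 2)) / (1 + x (d - 2))))"
    by (simp only: sigma'_def \<tau>_def o_def)
  also have "\<dots> = 1 / y (d + 1) * (T d / T (d + 2)) *
      (y (d + 1) * x (d + 1) * y (d + 2) * (T (d + 3) / T (d + 1)) *
        (1 + 1 / y (d + 2) * (T (d + 1) / T (d + 3))) /
        (1 + y (d + 1) * x (d + 1) * y (d + 2) * (T (d + 3) / T (d + 1)))) *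
      (1 / y d * (T (d - 1) / T (d + 1)) *
        (1 + y (d - 1) * x (d - 1) * y d * (T (d + 1) / T (d - 1))) /
        (1 + 1 / y d * (T (d - 1) / T (d + 1))))"
  proof -
    have "d - 1 + 1 = d" "d - 1 + 2 = d + 1" "d - 1 + 3 = d + 2"
      "d - 2 + 1 = d - 1" "d - 2 + 2 = d" "d - 2 + 3 = d + 1" by simp_all
    then show ?thesis by (simp only: field_hom_simps[OF hom] \<tau>x \<tau>y)
  qed
  also have "\<dots> = x (d + 1) * T d * (y (d + 2) * T (d + 3) + T (d + 1)) *
      (T (d - 1) + y (d - 1) * x (d - 1) * y d * T (d + 1)) /
      (T (d + 2) * (T (d + 1) + y (d + 1) * x (d + 1) * y (d + 2) * T (d + 3)) *
        (y d * T (d + 1) + T (d - 1)))"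
  proof (rule sigma'_algebra)
    \<comment> \<open>At the origin all x and y vanish and every T becomes 1, so this sum and the
      next both become 1.\<close>
    show "T (d + 1) + y (d + 1) * x (d + 1) * y (d + 2) * T (d + 3) \<noteq> 0"
      by (rule specializes_zero_nonzero, (rule specializes_intros x0 y0 T0)+, simp)
    show "y d * T (d + 1) + T (d - 1) \<noteq> 0"
      by (rule specializes_zero_nonzero, (rule specializes_intros x0 y0 T0)+, simp)
  qed (simp_all add: nz Tnz)
  \<comment> \<open>The two sums free of x factor already before specialization. The T (d + 2) and T
    d obtained here will cancel at the end.\<close>
  also have "y (d + 2) * T (d + 3) + T (d + 1) = T (d + 2) * (1 + y (d + 1))"
    using T_pair[of "d + 1"] by (simp add: add.assoc)
  also have "y d * T (d + 1) + T (d - 1) = T d * (1 + y (d - 1))"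
    using T_pair[of "d - 1"] by simp
  finally have sigma: "sigma' n (phi n m 1) =
      x (d + 1) * T d * (T (d + 2) * (1 + y (d + 1))) *
      (T (d - 1) + y (d - 1) * x (d - 1) * y d * T (d + 1)) /
      (T (d + 2) * (T (d + 1) + y (d + 1) * x (d + 1) * y (d + 2) * T (d + 3)) *
        (T d * (1 + y (d - 1))))" .
  \<comment> \<open>y k is phi_(-k,1-k), whose indices have opposite parity, so epsilon fixes it and
    hence every T k. Among the x k = phi_(-k,-k), those with k odd become -1.\<close>
  have ey: "specializes (eps_img n) (y k) (y k)" for k
    unfolding y_def phi'_def by (rule eps_fix) simp
  have eT: "specializes (eps_img n) (T k) (T k)" for k
    unfolding T_def seg_sum_def seg_prod_def by (intro specializes_sum specializes_prod ey)
  have ex: "specializes (eps_img n) (x (d + 1)) (- 1)" "specializes (eps_img n) (x (d - 1)) (- 1)"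
    unfolding x_def phi'_def by (rule eps_odd; use d in simp)+
  \<comment> \<open>Once x is -1, the other two sums factor too: using the recursion twice leaves D
    (1 + y). The factors 1 + y are those from \<open>T_pair\<close>, now on the opposite side of the
    fraction.\<close>
  have A: "T (d - 1) + y (d - 1) * - 1 * y d * T (d + 1) = D * (1 + y (d - 1))"
  proof -
    have "T (d - 1) + y (d - 1) * - 1 * y d * T (d + 1) =
        (y (d - 1) * T (d - 1 + 1) + D) - y (d - 1) * (y d * T (d + 1))"
      unfolding rec[of "d - 1"] by (simp add: mult.assoc)
    also have "\<dots> = D * (1 + y (d - 1))"
      unfolding rec[of d] by (simp add: algebra_simps)
    finally show ?thesis .
  qed
  have B: "T (d + 1) + y (d + 1) * - 1 * y (d + 2) * T (d + 3) = D * (1 + y (d + 1))"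
  proof -
    have "T (d + 1) + y (d + 1) * - 1 * y (d + 2) * T (d + 3) =
        (y (d + 1) * T (d + 1 + 1) + D) - y (d + 1) * (y (d + 2) * T (d + 2 + 1))"
      unfolding rec[of "d + 1"] by (simp add: mult.assoc add.assoc)
    also have "\<dots> = D * (1 + y (d + 1))"
      unfolding rec[of "d + 2"] by (simp add: algebra_simps)
    finally show ?thesis .
  qed
  have "specializes (eps_img n) (sigma' n (phi n m 1))
      (- 1 * T d * (T (d + 2) * (1 + y (d + 1))) *
      (T (d - 1) + y (d - 1) * - 1 * y d * T (d + 1)) /
      (T (d + 2) * (T (d + 1) + y (d + 1) * - 1 * y (d + 2) * T (d + 3)) *
        (T d * (1 + y (d - 1)))))"
    unfolding sigma
    by (intro specializes_mult specializes_add specializes_divide specializes_1 ex ey eT)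
      (unfold B, simp add: Tnz Dnz ynz)
  also have "\<dots> = - 1"
    unfolding A B using Tnz Dnz ynz by simp
  finally show "specializes (eps_img n) (sigma' n (phi n m 1)) (- 1)" .
qed

lemma consistent_omegas:
  assumes "n \<ge> 1" "\<omega> \<in> omegas n"
  shows "consistent n \<omega>"
proof -
  have e: "- 2 * int i - 2 = - 2 * int i - 3 + 1" "- 2 * int i - 3 = - 2 * int i - 4 + 1" for i
    by simp_all
  have "p n i = braid n (- 2 * int i - 3)" "p' n i = braid n (- 2 * int i - 4)" for i
    by (simp only: p_def braid_def[OF assms(1)] e(1))
      (simp only: p'_def braid_def[OF assms(1)] e(2))
  then show ?thesis
    using assms consistent_braid consistent_sigma consistent_sigma' consistent_pi1 consistent_pi2
    by (auto simp: omegas_def)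
qed

theorem theorem3p1:
  fixes n j :: nat and \<omega> :: "K \<Rightarrow> K"
  assumes "n \<ge> 1" and "\<omega> \<in> omegas n" and "j \<le> n"
  shows "eps n (\<omega> (phi n (2 * int j + 1) 1)) = Some (-1)
         \<and> (\<exists>v. eps n (\<omega> (alpha n (2 * int j + 1))) = Some v
                \<and> eps n (\<omega> (phi n (2 * int j + 1) 0)) = Some (- v))"
  by (rule consistent_eps[OF consistent_omegas]) (use assms in simp_all)

end
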